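(* For any integers $m,n$, the Baumslag-Solitar group $BS(m,n):=\langle s,t \mid st^ms^{-1}=t^n\rangle$ does not admit a translation-like action on the lamplighter group $(\mathbb{Z}/2\mathbb{Z})\wr\mathbb{Z}$, where $(\mathbb{Z}/2\mathbb{Z})\wr\mathbb{Z}$ is equipped with a left-invariant word metric associated to some finite symmetric generating set.
   Context: Word metric: for a finitely generated group $G$ with a finite symmetric generating set $T$, let $\ell_G$ be the word length associated to $T$ and let $d_G(x,y):=\ell_G(x^{-1}y)$ for $x,y\in G$; this is a left-invariant metric. Finitely generated groups are regarded as metric spaces in this way. Translation-like action: let $H$ be a group and $(X,d)$ a metric space. A left action $*$ of $H$ on (the set) $X$ is translation-like if (i) the action is free, i.e. $h*x=x$ for some $x\in X$ implies $h=1_H$; and (ii) for every $h\in H$ the set $\{d(x,h*x) : x\in X\}$ is bounded. A translation-like action of $H$ on a finitely generated group $G$ means a translation-like action on the metric space $(G,d_G)$ (an action on the underlying set of $G$). The lamplighter group $(\mathbb{Z}/2\mathbb{Z})\wr\mathbb{Z}$ is the restricted wreath product $\left(\bigoplus_{\mathbb{Z}}\mathbb{Z}/2\mathbb{Z}\right)\rtimes\mathbb{Z}$, with $\mathbb{Z}$ acting by shifting coordinates.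
   Formalization: The pairs where one of m, n is 0 and the other is 1 or -1 are excluded: there BS(m,n) is infinite cyclic and does act translation-like on the lamplighter group by right translations, so the claim fails for them. *)

theory Defs
  imports "HOL-Analysis.Analysis" "HOL-Algebra.Algebra"
begin

section \<open>Groups given by generators and relations\<close>

text \<open>
  Words over the generators, all elements of type \<open>'a\<close>, are lists of letters; the letter
  \<open>(x, True)\<close> stands for \<open>x\<close> and \<open>(x, False)\<close> for its formal inverse. A relation \<open>u = v\<close>
  is the pair \<open>(u, v)\<close>. The presented group consists of the classes of words modulo the
  least congruence that cancels inverse letters and identifies the two sides of each relation.
\<close>

type_synonym 'a word = "('a \<times> bool) list"

inductive word_eq :: "('a word \<times> 'a word) set \<Rightarrow> 'a word \<Rightarrow> 'a word \<Rightarrow> bool"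
  for R where
  refl: "word_eq R u u"
| sym: "word_eq R u v \<Longrightarrow> word_eq R v u"
| trans: "word_eq R u v \<Longrightarrow> word_eq R v w \<Longrightarrow> word_eq R u w"
| cancel: "word_eq R (u @ [(x, b), (x, \<not> b)] @ v) (u @ v)"
| relation: "(l, r) \<in> R \<Longrightarrow> word_eq R (u @ l @ v) (u @ r @ v)"

definition word_class :: "('a word \<times> 'a word) set \<Rightarrow> 'a word \<Rightarrow> 'a word set"
  where "word_class R u = {v. word_eq R u v}"

definition presented_group :: "('a word \<times> 'a word) set \<Rightarrow> 'a word set monoid"
  where "presented_group R =
    \<lparr>carrier = range (word_class R),
     monoid.mult = (\<lambda>A B. \<Union>u\<in>A. \<Union>v\<in>B. word_class R (u @ v)),
     one = word_class R []\<rparr>"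

lemma word_eq_append_left: "word_eq R u v \<Longrightarrow> word_eq R (w @ u) (w @ v)"
proof (induction rule: word_eq.induct)
  case (cancel u x b v)
  then show ?case using word_eq.cancel[of R "w @ u" x b v] by simp
next
  case (relation l r u v)
  then show ?case using word_eq.relation[of l r R "w @ u" v] by simp
next
  case (sym u v)
  show ?case by (rule word_eq.sym[OF sym.IH])
next
  case (trans u v z)
  show ?case by (rule word_eq.trans[OF trans.IH])
qed (rule word_eq.refl)

lemma word_eq_append_right: "word_eq R u v \<Longrightarrow> word_eq R (u @ w) (v @ w)"
proof (induction rule: word_eq.induct)
  case (cancel u x b v)
  then show ?case using word_eq.cancel[of R u x b "v @ w"] by simp
next
  case (relation l r u v)
  then show ?case using word_eq.relation[of l r R u "v @ w"] by simp
next
  case (sym u v)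
  show ?case by (rule word_eq.sym[OF sym.IH])
next
  case (trans u v z)
  show ?case by (rule word_eq.trans[OF trans.IH])
qed (rule word_eq.refl)

lemma word_eq_append:
  "word_eq R u u' \<Longrightarrow> word_eq R v v' \<Longrightarrow> word_eq R (u @ v) (u' @ v')"
  by (rule word_eq.trans[OF word_eq_append_right word_eq_append_left])

lemma word_class_eq_iff: "word_class R u = word_class R v \<longleftrightarrow> word_eq R u v"
proof
  assume "word_class R u = word_class R v"
  then have "v \<in> word_class R u"
    by (simp add: word_class_def word_eq.refl)
  then show "word_eq R u v"
    by (simp add: word_class_def)
next
  assume uv: "word_eq R u v"
  have "word_eq R u w \<longleftrightarrow> word_eq R v w" for w
    using word_eq.trans[OF uv, of w] word_eq.trans[OF word_eq.sym[OF uv], of w] by blast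
  then show "word_class R u = word_class R v"
    by (simp add: word_class_def)
qed

lemma mult_presented_group:
  "word_class R u \<otimes>\<^bsub>presented_group R\<^esub> word_class R v = word_class R (u @ v)"
proof -
  have "word_class R (u' @ v') = word_class R (u @ v)"
    if "u' \<in> word_class R u" "v' \<in> word_class R v" for u' v'
    unfolding word_class_eq_iff
    using that word_eq.sym[OF word_eq_append, of R u u' v v'] by (simp add: word_class_def)
  moreover have "u \<in> word_class R u" "v \<in> word_class R v"
    by (auto simp: word_class_def word_eq.refl)
  ultimately have "(\<Union>u'\<in>word_class R u. \<Union>v'\<in>word_class R v. word_class R (u' @ v')) = word_class R (u @ v)"
    by blast
  then show ?thesis
    by (simp add: presented_group_def)
qed

lemma carrier_presented_group: "carrier (presented_group R) = range (word_class R)"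
  by (simp add: presented_group_def)

lemma one_presented_group: "\<one>\<^bsub>presented_group R\<^esub> = word_class R []"
  by (simp add: presented_group_def)

lemma word_eq_inverse: "word_eq R (rev (map (\<lambda>(x, b). (x, \<not> b)) u) @ u) []"
proof (induction u)
  case Nil
  then show ?case by (simp add: word_eq.refl)
next
  case (Cons a u)
  obtain x b where a: "a = (x, b)" by (cases a)
  show ?case
    using word_eq.cancel[of R "rev (map (\<lambda>(x, b). (x, \<not> b)) u)" x "\<not> b" u, THEN word_eq.trans, OF Cons.IH]
    by (simp add: a)
qed

lemma group_presented_group: "group (presented_group R)"
proof (rule groupI)
  fix A assume "A \<in> carrier (presented_group R)"
  then obtain u where A: "A = word_class R u"
    by (auto simp: carrier_presented_group)
  have "word_class R (rev (map (\<lambda>(x, b). (x, \<not> b)) u)) \<otimes>\<^bsub>presented_group R\<^esub> A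
      = \<one>\<^bsub>presented_group R\<^esub>"
    by (simp add: A mult_presented_group one_presented_group word_class_eq_iff word_eq_inverse)
  then show "\<exists>B\<in>carrier (presented_group R). B \<otimes>\<^bsub>presented_group R\<^esub> A = \<one>\<^bsub>presented_group R\<^esub>"
    by (auto simp: carrier_presented_group)
qed (auto simp: carrier_presented_group one_presented_group mult_presented_group)

section \<open>Baumslag--Solitar groups\<close>

datatype bs_gen = Gen_s | Gen_t

definition word_int_pow :: "'a \<Rightarrow> int \<Rightarrow> 'a word"
  where "word_int_pow x k = replicate (nat \<bar>k\<bar>) (x, 0 \<le> k)"

text \<open>
  The presentation \<open>\<langle>s, t | s t\<^sup>m s\<^sup>-\<^sup>1 = t\<^sup>n\<rangle>\<close> makes sense for all integers \<open>m\<close>, \<open>n\<close>. If one of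
  them is \<open>0\<close> and the other is \<open>1\<close> or \<open>-1\<close>, the relation says \<open>t = 1\<close> and the group is infinite
  cyclic; then it acts translation-like, by right translations, on every group with an element
  of infinite order.
\<close>

definition baumslag_solitar :: "int \<Rightarrow> int \<Rightarrow> bs_gen word set monoid"
  where "baumslag_solitar m n =
    presented_group
      {([(Gen_s, True)] @ word_int_pow Gen_t m @ [(Gen_s, False)], word_int_pow Gen_t n)}"

section \<open>The lamplighter group\<close>

definition semidirect_product ::
    "('a, 'c) monoid_scheme \<Rightarrow> ('b, 'd) monoid_scheme \<Rightarrow> ('b \<Rightarrow> 'a \<Rightarrow> 'a) \<Rightarrow> ('a \<times> 'b) monoid"
  where "semidirect_product N H \<theta> =
    \<lparr>carrier = carrier N \<times> carrier H,
     monoid.mult = (\<lambda>(a, h) (b, k). (a \<otimes>\<^bsub>N\<^esub> \<theta> h b, h \<otimes>\<^bsub>H\<^esub> k)),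
     one = (\<one>\<^bsub>N\<^esub>, \<one>\<^bsub>H\<^esub>)\<rparr>"

definition lamplighter :: "((int \<Rightarrow> int) \<times> int) monoid"
  where "lamplighter =
    semidirect_product (sum_group UNIV (\<lambda>_ :: int. integer_mod_group 2)) integer_group
      (\<lambda>k f i. f (i - k))"

lemma group_lamplighter: "group lamplighter"
proof -
  define N where "N = sum_group UNIV (\<lambda>_ :: int. integer_mod_group 2)"
  define S :: "int \<Rightarrow> (int \<Rightarrow> int) \<Rightarrow> int \<Rightarrow> int" where "S k f = (\<lambda>i. f (i - k))" for k f
  interpret N: group N
    unfolding N_def by (rule sum_group) simp
  have S_closed: "S k f \<in> carrier N" if "f \<in> carrier N" for k f
  proof -
    have "finite {i. f i \<noteq> 0}" "\<And>i. f i \<in> carrier (integer_mod_group 2)"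
      using that by (auto simp: N_def carrier_sum_group)
    moreover have "{i. f (i - k) \<noteq> 0} \<subseteq> (\<lambda>i. i + k) ` {i. f i \<noteq> 0}"
    proof
      fix i assume "i \<in> {i. f (i - k) \<noteq> 0}"
      then show "i \<in> (\<lambda>i. i + k) ` {i. f i \<noteq> 0}"
        by (intro image_eqI[of _ _ "i - k"]) auto
    qed
    ultimately have "finite {i. f (i - k) \<noteq> 0}" "\<And>i. f (i - k) \<in> carrier (integer_mod_group 2)"
      by (meson finite_imageI finite_subset, blast)
    then show ?thesis
      by (simp add: N_def S_def carrier_sum_group PiE_iff)
  qed
  have S_mult: "S k (f \<otimes>\<^bsub>N\<^esub> g) = S k f \<otimes>\<^bsub>N\<^esub> S k g" for k f g
    by (simp add: N_def S_def restrict_def)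
  have S_one: "S k \<one>\<^bsub>N\<^esub> = \<one>\<^bsub>N\<^esub>" for k
    by (simp add: N_def S_def restrict_def)
  have S_S: "S j (S k f) = S (j + k) f" and S_0: "S 0 f = f" for j k f
    by (simp_all add: S_def diff_diff_eq)
  have L: "lamplighter = semidirect_product N integer_group S"
    unfolding lamplighter_def N_def S_def ..
  have car: "carrier lamplighter = carrier N \<times> UNIV"
    and mult: "(f, j) \<otimes>\<^bsub>lamplighter\<^esub> (g, k) = (f \<otimes>\<^bsub>N\<^esub> S j g, j + k)"
    and one: "\<one>\<^bsub>lamplighter\<^esub> = (\<one>\<^bsub>N\<^esub>, 0)" for f j g k
    by (simp_all add: L semidirect_product_def)
  show ?thesis
  proof (rule groupI)
    fix x assume "x \<in> carrier lamplighter"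
    then obtain f k where x: "x = (f, k)" and f: "f \<in> carrier N"
      by (auto simp: car)
    have "(S (- k) (inv\<^bsub>N\<^esub> f), - k) \<otimes>\<^bsub>lamplighter\<^esub> x = \<one>\<^bsub>lamplighter\<^esub>"
      using f S_mult[of "- k" "inv\<^bsub>N\<^esub> f" f] by (simp add: x mult one S_one)
    moreover have "(S (- k) (inv\<^bsub>N\<^esub> f), - k) \<in> carrier lamplighter"
      using f by (simp add: car S_closed)
    ultimately show "\<exists>y\<in>carrier lamplighter. y \<otimes>\<^bsub>lamplighter\<^esub> x = \<one>\<^bsub>lamplighter\<^esub>"
      by blast
  qed (auto simp: car mult one S_closed S_mult S_S S_0 N.m_assoc)
qed

section \<open>Word metrics and translation-like actions\<close>

definition symmetric_generating_set :: "('a, 'b) monoid_scheme \<Rightarrow> 'a set \<Rightarrow> bool"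
  where "symmetric_generating_set G T \<longleftrightarrow>
    T \<subseteq> carrier G \<and> (\<forall>t\<in>T. inv\<^bsub>G\<^esub> t \<in> T) \<and> generate G T = carrier G"

definition word_length :: "('a, 'b) monoid_scheme \<Rightarrow> 'a set \<Rightarrow> 'a \<Rightarrow> nat"
  where "word_length G T g =
    (LEAST k. \<exists>ts. length ts = k \<and> set ts \<subseteq> T \<and> foldr (\<otimes>\<^bsub>G\<^esub>) ts \<one>\<^bsub>G\<^esub> = g)"

definition word_metric :: "('a, 'b) monoid_scheme \<Rightarrow> 'a set \<Rightarrow> 'a \<Rightarrow> 'a \<Rightarrow> real"
  where "word_metric G T x y = real (word_length G T (inv\<^bsub>G\<^esub> x \<otimes>\<^bsub>G\<^esub> y))"

text \<open>
  The predicate \<^term>\<open>group_action H M\<close> only admits maps that are \<open>undefined\<close> outside \<open>M\<close>; every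
  action of \<open>H\<close> on \<open>M\<close> becomes one of these by restricting each map to \<open>M\<close>.
\<close>

definition translation_like_action ::
    "('h, 'c) monoid_scheme \<Rightarrow> 'x set \<Rightarrow> ('x \<Rightarrow> 'x \<Rightarrow> real) \<Rightarrow> ('h \<Rightarrow> 'x \<Rightarrow> 'x) \<Rightarrow> bool"
  where "translation_like_action H M d act \<longleftrightarrow>
    group_action H M act \<and>
    (\<forall>h\<in>carrier H. (\<exists>x\<in>M. act h x = x) \<longrightarrow> h = \<one>\<^bsub>H\<^esub>) \<and>
    (\<forall>h\<in>carrier H. bounded {d x (act h x) |x. x \<in> M})"

end

theory Submission
  imports Defs
begin

text \<open>
  For nonzero \<open>m\<close>, \<open>n\<close> the obstruction is asymptotic dimension. The lamplighter group has
  dimension one: cut it into slabs of thickness \<open>L\<close> according to the position of the lamplighter and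
  colour the slabs alternately; a monochromatic chain of short steps stays in one slab, hence changes
  only boundedly many lamps. In \<open>BS(m,n)\<close> the elements \<open>t\<^sup>a s\<^sup>-\<^sup>y\<close> form, via the relation
  \<open>s\<^sup>-\<^sup>1 t\<^sup>n = t\<^sup>m s\<^sup>-\<^sup>1\<close>, arbitrarily large grids whose neighbouring points differ by left
  multiplication with an element of a fixed finite set. Such a grid acts on a base point to give a
  coloured grid in the lamplighter group, and by the Hex theorem some monochromatic chain crosses
  it. By freeness this chain has arbitrarily many points, a contradiction.

  If one exponent vanishes, the group is a free product of an infinite cyclic group and a cyclic
  group that is not trivial. It has a paradoxical decomposition by ping-pong, which a free action of
  bounded displacement transports to the lamplighter group, contradicting its amenability.
\<close>

section \<open>Actions of presented groups\<close>

definition word_act :: "('a \<Rightarrow> bool \<Rightarrow> 'x \<Rightarrow> 'x) \<Rightarrow> 'a word \<Rightarrow> 'x \<Rightarrow> 'x"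
  where "word_act f w = foldr (\<lambda>(x, b). f x b) w"

lemma word_act_simps [simp]:
  "word_act f [] = id"
  "word_act f ((x, b) # w) = f x b \<circ> word_act f w"
  "word_act f (u @ v) = word_act f u \<circ> word_act f v"
proof -
  show "word_act f (u @ v) = word_act f u \<circ> word_act f v"
    by (induction u) (simp_all add: word_act_def)
qed (simp_all add: word_act_def)

lemma word_act_word_eq:
  assumes "word_eq R u v"
    and "\<And>x b z. f x b (f x (\<not> b) z) = z"
    and "\<And>l r. (l, r) \<in> R \<Longrightarrow> word_act f l = word_act f r"
  shows "word_act f u = word_act f v"
  using assms(1)
proof induction
  case (cancel u x b v)
  then show ?case using assms(2) by (simp add: fun_eq_iff)
qed (simp_all add: assms(3))

text \<open>The universal property of a presentation: permutations satisfying the relations make the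
  group act. Concrete actions obtained this way separate elements and set up the ping-pong, in place
  of a normal form for words.\<close>

lemma presented_group_acts:
  assumes "\<And>x b z. f x b (f x (\<not> b) z) = z"
    and "\<And>l r. (l, r) \<in> R \<Longrightarrow> word_act f l = word_act f r"
  obtains \<phi> where "\<And>u. \<phi> (word_class R u) = word_act f u"
    and "\<And>g h. g \<in> carrier (presented_group R) \<Longrightarrow> h \<in> carrier (presented_group R) \<Longrightarrow>
      \<phi> (g \<otimes>\<^bsub>presented_group R\<^esub> h) = \<phi> g \<circ> \<phi> h"
proof
  define \<phi> where "\<phi> g = word_act f (SOME u. g = word_class R u)" for g
  show \<phi>: "\<phi> (word_class R u) = word_act f u" for u
  proof -
    have "word_class R u = word_class R (SOME v. word_class R u = word_class R v)"
      by (rule someI) (rule HOL.refl)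
    then show ?thesis
      unfolding \<phi>_def word_class_eq_iff using word_act_word_eq[OF _ assms] by metis
  qed
  show "\<phi> (g \<otimes>\<^bsub>presented_group R\<^esub> h) = \<phi> g \<circ> \<phi> h"
    if "g \<in> carrier (presented_group R)" "h \<in> carrier (presented_group R)" for g h
    using that by (auto simp: carrier_presented_group mult_presented_group \<phi>)
qed

lemma inv_word_class:
  "inv\<^bsub>presented_group R\<^esub> word_class R [(x, b)] = word_class R [(x, \<not> b)]"
proof -
  interpret group "presented_group R" by (rule group_presented_group)
  have "word_eq R ([] @ [(x, \<not> b), (x, \<not> \<not> b)] @ []) ([] @ [])"
    by (rule word_eq.cancel)
  then have "word_class R [(x, \<not> b)] \<otimes>\<^bsub>presented_group R\<^esub> word_class R [(x, b)]
      = \<one>\<^bsub>presented_group R\<^esub>"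
    by (simp add: mult_presented_group one_presented_group word_class_eq_iff)
  then show ?thesis
    by (rule inv_equality) (simp_all add: carrier_presented_group)
qed

lemma word_class_replicate:
  "word_class R (replicate k (x, b)) = word_class R [(x, b)] [^]\<^bsub>presented_group R\<^esub> k"
proof (induction k)
  case (Suc k)
  then show ?case
    by (metis mult_presented_group nat_pow_Suc replicate_Suc replicate_append_same)
qed (simp add: one_presented_group)

lemma word_class_word_int_pow:
  "word_class R (word_int_pow x k) = word_class R [(x, True)] [^]\<^bsub>presented_group R\<^esub> k"
proof -
  interpret group "presented_group R" by (rule group_presented_group)
  have x: "word_class R [(x, True)] \<in> carrier (presented_group R)"
    by (simp add: carrier_presented_group)
  show ?thesis
  proof (cases "0 \<le> k")
    case True
    then have "word_int_pow x k = replicate (nat k) (x, True)"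
      by (simp add: word_int_pow_def)
    moreover have "word_class R [(x, True)] [^]\<^bsub>presented_group R\<^esub> k =
        word_class R [(x, True)] [^]\<^bsub>presented_group R\<^esub> nat k"
      using int_pow_int[of "presented_group R" "word_class R [(x, True)]" "nat k"] True by (simp only: nat_0_le)
    ultimately show ?thesis
      by (simp only: word_class_replicate)
  next
    case False
    then have "word_int_pow x k = replicate (nat (- k)) (x, False)"
      by (simp add: word_int_pow_def)
    moreover have "word_class R [(x, True)] [^]\<^bsub>presented_group R\<^esub> k =
        word_class R [(x, False)] [^]\<^bsub>presented_group R\<^esub> nat (- k)"
      using int_pow_neg_int[OF x, of "nat (- k)"] nat_pow_inv[OF x, of "nat (- k)"] False
      by (simp only: inv_word_class nat_0_le) simp
    ultimately show ?thesis
      by (simp only: word_class_replicate)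
  qed
qed

section \<open>The geometry of the lamplighter group\<close>

text \<open>Closure of \<open>T\<close> under inverses turns the inverse case of
  \<open>generate\<close> into a one-letter word. Consequently the minimum in
  \<open>word_length\<close> is taken over a nonempty set and is attained.\<close>

lemma foldr_mult_generate:
  assumes "group G" "symmetric_generating_set G T" "g \<in> carrier G"
  shows "\<exists>ts. set ts \<subseteq> T \<and> foldr (\<otimes>\<^bsub>G\<^esub>) ts \<one>\<^bsub>G\<^esub> = g"
proof -
  interpret group G by fact
  have T: "T \<subseteq> carrier G" "\<And>t. t \<in> T \<Longrightarrow> inv\<^bsub>G\<^esub> t \<in> T" "g \<in> generate G T"
    using assms unfolding symmetric_generating_set_def by auto
  have closed: "foldr (\<otimes>\<^bsub>G\<^esub>) ts \<one>\<^bsub>G\<^esub> \<in> carrier G" if "set ts \<subseteq> T" for ts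
    using that T(1) by (induction ts) auto
  have app: "foldr (\<otimes>\<^bsub>G\<^esub>) (us @ ts) \<one>\<^bsub>G\<^esub> =
      foldr (\<otimes>\<^bsub>G\<^esub>) us \<one>\<^bsub>G\<^esub> \<otimes>\<^bsub>G\<^esub> foldr (\<otimes>\<^bsub>G\<^esub>) ts \<one>\<^bsub>G\<^esub>"
    if "set us \<subseteq> T" "set ts \<subseteq> T" for us ts
    using that(1)
  proof (induction us)
    case Nil
    then show ?case using closed[OF that(2)] by simp
  next
    case (Cons u us)
    then show ?case using closed[OF that(2)] closed[of us] T(1) by (auto simp: m_assoc)
  qed
  from T(3) show ?thesis
  proof (induction rule: generate.induct)
    case one
    show ?case by (rule exI[of _ "[]"]) simp
  next
    case (incl h)
    then show ?case using T(1) by (intro exI[of _ "[h]"]) auto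
  next
    case (inv h)
    then show ?case using T(1,2) by (intro exI[of _ "[inv\<^bsub>G\<^esub> h]"]) auto
  next
    case (eng h1 h2)
    then obtain us ts where "set us \<subseteq> T" "foldr (\<otimes>\<^bsub>G\<^esub>) us \<one>\<^bsub>G\<^esub> = h1"
      "set ts \<subseteq> T" "foldr (\<otimes>\<^bsub>G\<^esub>) ts \<one>\<^bsub>G\<^esub> = h2" by blast
    then show ?case using app[of us ts] by (intro exI[of _ "us @ ts"]) auto
  qed
qed

lemma finite_word_length_ball:
  assumes "group G" "symmetric_generating_set G T" "finite T"
  shows "finite {g \<in> carrier G. word_length G T g \<le> n}"
proof (rule finite_subset)
  show "{g \<in> carrier G. word_length G T g \<le> n}
      \<subseteq> (\<lambda>ts. foldr (\<otimes>\<^bsub>G\<^esub>) ts \<one>\<^bsub>G\<^esub>) ` {ts. set ts \<subseteq> T \<and> length ts \<le> n}"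
  proof
    fix g assume "g \<in> {g \<in> carrier G. word_length G T g \<le> n}"
    then have g: "g \<in> carrier G" "word_length G T g \<le> n" by auto
    have "\<exists>k ts. length ts = k \<and> set ts \<subseteq> T \<and> foldr (\<otimes>\<^bsub>G\<^esub>) ts \<one>\<^bsub>G\<^esub> = g"
      using foldr_mult_generate[OF assms(1,2) g(1)] by blast
    from LeastI_ex[OF this] obtain ts where "length ts = word_length G T g" "set ts \<subseteq> T"
      "foldr (\<otimes>\<^bsub>G\<^esub>) ts \<one>\<^bsub>G\<^esub> = g"
      unfolding word_length_def by blast
    with g(2) show "g \<in> (\<lambda>ts. foldr (\<otimes>\<^bsub>G\<^esub>) ts \<one>\<^bsub>G\<^esub>) ` {ts. set ts \<subseteq> T \<and> length ts \<le> n}"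
      by auto
  qed
  show "finite ((\<lambda>ts. foldr (\<otimes>\<^bsub>G\<^esub>) ts \<one>\<^bsub>G\<^esub>) ` {ts. set ts \<subseteq> T \<and> length ts \<le> n})"
    using finite_lists_length_le[OF assms(3)] by simp
qed

text \<open>All quotients of \<open>f x\<close> by \<open>x\<close> lie in one ball, and balls are
  finite. Boundedness of a displacement thus becomes finiteness of a set of right
  multipliers.\<close>

lemma finite_displacements:
  assumes "group G" "symmetric_generating_set G T" "finite T"
    and "bounded {word_metric G T x (f x) |x. x \<in> carrier G}"
    and "f ` carrier G \<subseteq> carrier G"
  shows "finite {inv\<^bsub>G\<^esub> x \<otimes>\<^bsub>G\<^esub> f x |x. x \<in> carrier G}"
proof -
  interpret group G by fact
  obtain c where c: "\<And>x. x \<in> carrier G \<Longrightarrow> word_metric G T x (f x) \<le> c"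
  proof -
    obtain c where "\<forall>v\<in>{word_metric G T x (f x) |x. x \<in> carrier G}. norm v \<le> c"
      using assms(4) unfolding bounded_iff by blast
    then have "word_metric G T x (f x) \<le> c" if "x \<in> carrier G" for x
      using that by (metis (mono_tags, lifting) abs_ge_self mem_Collect_eq order_trans real_norm_def)
    then show ?thesis using that by blast
  qed
  show ?thesis
  proof (rule finite_subset[OF _ finite_word_length_ball[OF assms(1-3), of "nat \<lceil>c\<rceil>"]], safe)
    fix x assume x: "x \<in> carrier G"
    with assms(5) show "inv\<^bsub>G\<^esub> x \<otimes>\<^bsub>G\<^esub> f x \<in> carrier G" by auto
    show "word_length G T (inv\<^bsub>G\<^esub> x \<otimes>\<^bsub>G\<^esub> f x) \<le> nat \<lceil>c\<rceil>"
      using c[OF x] unfolding word_metric_def by linarith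
  qed
qed

section \<open>Coordinates and bounded steps in the lamplighter group\<close>

lemma mem_carrier_lamplighter:
  "(f, k) \<in> carrier lamplighter \<longleftrightarrow> (\<forall>i. f i \<in> {0, 1}) \<and> finite {i. f i \<noteq> 0}"
proof -
  have "carrier (integer_mod_group 2) = {0, 1}"
    by (auto simp: carrier_integer_mod_group)
  then show ?thesis
    by (simp add: lamplighter_def semidirect_product_def carrier_sum_group PiE_iff)
qed

lemma mult_lamplighter:
  "(f, j) \<otimes>\<^bsub>lamplighter\<^esub> (g, k) = (\<lambda>i. (f i + g (i - j)) mod 2, j + k)"
  by (simp add: lamplighter_def semidirect_product_def restrict_def)

text \<open>A coarse substitute for the word metric: right multiplication by elements of a finite
  set moves the lamplighter boundedly and switches only lamps near the starting position
  \<open>j\<close>.\<close>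

definition lamp_near :: "int \<Rightarrow> (int \<Rightarrow> int) \<times> int \<Rightarrow> (int \<Rightarrow> int) \<times> int \<Rightarrow> bool"
  where "lamp_near r = (\<lambda>(f, j) (g, k). \<bar>k - j\<bar> \<le> r \<and> (\<forall>i. \<bar>i - j\<bar> > r \<longrightarrow> g i = f i))"

lemma finite_lamp_near:
  assumes "finite S" "S \<subseteq> carrier lamplighter"
  obtains r where "\<And>x y. x \<in> carrier lamplighter \<Longrightarrow> y \<in> carrier lamplighter \<Longrightarrow>
      inv\<^bsub>lamplighter\<^esub> x \<otimes>\<^bsub>lamplighter\<^esub> y \<in> S \<Longrightarrow> lamp_near r x y" and "r > 0"
proof -
  interpret group lamplighter by (rule group_lamplighter)
  define A where "A = (\<Union>s\<in>S. insert (snd s) {i. fst s i \<noteq> 0})"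
  have "finite A"
    using assms unfolding A_def by (auto simp: mem_carrier_lamplighter subset_iff)
  \<comment> \<open>Inserting \<open>1\<close> makes \<open>Max\<close> meaningful for empty
    \<open>A\<close> and \<open>r\<close> positive in every case.\<close>
  define r where "r = Max (insert 1 (abs ` A))"
  have r: "\<bar>a\<bar> \<le> r" if "a \<in> A" for a
    using \<open>finite A\<close> that by (auto simp: r_def intro!: Max_ge)
  have "1 \<le> r"
    using \<open>finite A\<close> by (auto simp: r_def intro!: Max_ge)
  show ?thesis
  proof (rule that)
    fix x y
    assume x: "x \<in> carrier lamplighter" and y: "y \<in> carrier lamplighter"
      and xy: "inv\<^bsub>lamplighter\<^esub> x \<otimes>\<^bsub>lamplighter\<^esub> y \<in> S"
    obtain f j where fj: "x = (f, j)" by (cases x)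
    obtain g k where gk: "inv\<^bsub>lamplighter\<^esub> x \<otimes>\<^bsub>lamplighter\<^esub> y = (g, k)"
      by (cases "inv\<^bsub>lamplighter\<^esub> x \<otimes>\<^bsub>lamplighter\<^esub> y")
    have "y = x \<otimes>\<^bsub>lamplighter\<^esub> (g, k)"
      using x y by (simp flip: gk m_assoc)
    then have y': "y = (\<lambda>i. (f i + g (i - j)) mod 2, j + k)"
      by (simp add: fj mult_lamplighter)
    have "(g, k) \<in> S" using xy gk by simp
    then have "k \<in> A" and g: "\<And>i. g i \<noteq> 0 \<Longrightarrow> i \<in> A"
      unfolding A_def by (auto intro!: bexI[of _ "(g, k)"])
    have "(f i + g (i - j)) mod 2 = f i" if "\<bar>i - j\<bar> > r" for i
    proof -
      have "i - j \<notin> A" using r[of "i - j"] that by linarith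
      then have "g (i - j) = 0" using g[of "i - j"] by blast
      moreover have "f i \<in> {0, 1}" using x by (simp add: fj mem_carrier_lamplighter)
      ultimately show ?thesis by auto
    qed
    then show "lamp_near r x y"
      using r[OF \<open>k \<in> A\<close>] by (simp add: lamp_near_def fj y')
  qed (use \<open>1 \<le> r\<close> in simp)
qed

section \<open>Asymptotic dimension at most one\<close>

definition lamp_steps ::
    "int \<Rightarrow> ((int \<Rightarrow> int) \<times> int \<Rightarrow> bool) \<Rightarrow> (((int \<Rightarrow> int) \<times> int) \<times> ((int \<Rightarrow> int) \<times> int)) set"
  where "lamp_steps r col = {(x, y). x \<in> carrier lamplighter \<and> y \<in> carrier lamplighter \<and>
    lamp_near r x y \<and> col x = col y}"

text \<open>A slab of thickness \<open>r + 1\<close> cannot be jumped by a step of length at most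
  \<open>r\<close>, so a monochromatic chain never reaches another slab of its own colour. Only the
  lamps in the window \<open>W\<close> around the slab can then change, and counting configurations
  gives a bound independent of \<open>x\<close>.\<close>

lemma lamplighter_bounded_components:
  fixes r :: int
  assumes "r > 0"
  obtains col B where "\<And>x. x \<in> carrier lamplighter \<Longrightarrow>
    finite {y. (x, y) \<in> (lamp_steps r col)\<^sup>*} \<and> card {y. (x, y) \<in> (lamp_steps r col)\<^sup>*} \<le> B"
proof -
  define L where "L = r + 1"
  have "L > 0" using assms by (simp add: L_def)
  define col :: "(int \<Rightarrow> int) \<times> int \<Rightarrow> bool" where "col x = even (snd x div L)" for x
  define R where "R = lamp_steps r col"
  have "finite {y. (x, y) \<in> R\<^sup>*} \<and> card {y. (x, y) \<in> R\<^sup>*} \<le> 2 ^ nat (L + 2 * r + 1) * nat L"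
    if x: "x \<in> carrier lamplighter" for x
  proof -
    obtain f k where fk: "x = (f, k)" by (cases x)
    define q where "q = k div L"
    define W where "W = {q * L - r .. q * L + L + r}"
    define Y where "Y = {y \<in> carrier lamplighter. snd y div L = q \<and> (\<forall>i. i \<notin> W \<longrightarrow> fst y i = f i)}"
    have "y \<in> Y" if "(x, y) \<in> R\<^sup>*" for y
      using that
    proof (induction rule: rtrancl_induct)
      case base
      then show ?case using x by (simp add: Y_def fk q_def)
    next
      case (step y z)
      obtain g j where y: "y = (g, j)" by (cases y)
      obtain h l where z: "z = (h, l)" by (cases z)
      have j: "j div L = q" "\<And>i. i \<notin> W \<Longrightarrow> g i = f i" using step.IH by (auto simp: Y_def y)
      have jl: "\<bar>l - j\<bar> \<le> r" "\<And>i. \<bar>i - j\<bar> > r \<Longrightarrow> h i = g i" "even (j div L) = even (l div L)"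
        "z \<in> carrier lamplighter"
        using step.hyps(2) by (auto simp: R_def lamp_steps_def lamp_near_def y z col_def)
      have "l div L = q"
      proof -
        have bnd: "q * L \<le> j" "j < q * L + L"
          using div_mult_mod_eq[of j L] pos_mod_bound[OF \<open>L > 0\<close>, of j] pos_mod_sign[OF \<open>L > 0\<close>, of j]
          unfolding j(1) by linarith+
        have "(q - 1) * L \<le> l" "l < (q + 2) * L"
          using bnd jl(1) by (auto simp: L_def algebra_simps)
        moreover have "l div L * L \<le> l" "l < (l div L + 1) * L"
          using div_mult_mod_eq[of l L] pos_mod_bound[OF \<open>L > 0\<close>, of l] pos_mod_sign[OF \<open>L > 0\<close>, of l]
          unfolding distrib_right mult_1 by linarith+
        ultimately have "(q - 1) * L < (l div L + 1) * L" "l div L * L < (q + 2) * L"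
          by linarith+
        then have "q - 1 < l div L + 1" "l div L < q + 2"
          using \<open>L > 0\<close> by (auto dest: mult_right_less_imp_less)
        moreover have "d = q" if "q - 1 < d + 1" "d < q + 2" "even q = even d" for d
          using that by presburger
        ultimately show ?thesis using jl(3) j(1) by blast
      qed
      moreover have "h i = f i" if "i \<notin> W" for i
      proof -
        have "q * L \<le> j" "j < q * L + L"
          using div_mult_mod_eq[of j L] pos_mod_bound[OF \<open>L > 0\<close>, of j] pos_mod_sign[OF \<open>L > 0\<close>, of j]
          unfolding j(1) by linarith+
        then have "\<bar>i - j\<bar> > r" using that by (auto simp: W_def)
        then show ?thesis using jl(2) j(2)[OF that] by simp
      qed
      ultimately show ?case using jl(4) by (simp add: Y_def z)
    qed
    then have sub: "{y. (x, y) \<in> R\<^sup>*} \<subseteq> Y" by blast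
    \<comment> \<open>Outside \<open>W\<close> every member of \<open>Y\<close> agrees with
      \<open>f\<close>, so restricting the lamps to \<open>W\<close> loses nothing and embeds
      \<open>Y\<close> into the finite set \<open>Z\<close>.\<close>
    define \<Phi> where "\<Phi> y = (restrict (fst y) W, snd y)" for y :: "(int \<Rightarrow> int) \<times> int"
    define Z where "Z = (W \<rightarrow>\<^sub>E {0, 1 :: int}) \<times> {q * L ..< q * L + L}"
    have "inj_on \<Phi> Y"
    proof (rule inj_onI)
      fix y z assume y: "y \<in> Y" and z: "z \<in> Y" and eq: "\<Phi> y = \<Phi> z"
      have "fst y i = fst z i" for i
      proof (cases "i \<in> W")
        case True
        moreover have "restrict (fst y) W = restrict (fst z) W" using eq by (simp add: \<Phi>_def)
        ultimately show ?thesis by (metis restrict_apply')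
      next
        case False
        then show ?thesis using y z by (simp add: Y_def)
      qed
      moreover have "snd y = snd z" using eq by (simp add: \<Phi>_def)
      ultimately show "y = z" by (simp add: prod_eq_iff fun_eq_iff)
    qed
    have "\<Phi> ` Y \<subseteq> Z"
    proof
      fix w assume "w \<in> \<Phi> ` Y"
      then obtain g j where y: "(g, j) \<in> Y" "w = \<Phi> (g, j)" by (metis imageE surj_pair)
      have "j div L = q" using y by (simp add: Y_def)
      then have "q * L \<le> j" "j < q * L + L"
        using div_mult_mod_eq[of j L] pos_mod_bound[OF \<open>L > 0\<close>, of j] pos_mod_sign[OF \<open>L > 0\<close>, of j]
        by auto
      moreover have "g i \<in> {0, 1}" for i using y by (auto simp: Y_def mem_carrier_lamplighter)
      ultimately show "w \<in> Z" by (auto simp: Z_def y \<Phi>_def)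
    qed
    have "finite Z" by (auto simp: Z_def W_def intro!: finite_PiE)
    have "card Z = 2 ^ nat (L + 2 * r + 1) * nat L"
      by (simp add: Z_def W_def card_cartesian_product card_PiE algebra_simps flip: numeral_2_eq_2)
    with card_inj_on_le[OF \<open>inj_on \<Phi> Y\<close> \<open>\<Phi> ` Y \<subseteq> Z\<close> \<open>finite Z\<close>]
    have "card Y \<le> 2 ^ nat (L + 2 * r + 1) * nat L" by simp
    moreover have "finite Y"
      using \<open>inj_on \<Phi> Y\<close> \<open>\<Phi> ` Y \<subseteq> Z\<close> \<open>finite Z\<close> by (rule inj_on_finite)
    ultimately show ?thesis
      using sub by (meson card_mono finite_subset order_trans)
  qed
  then show ?thesis
    unfolding R_def by (rule that)
qed

section \<open>Amenability and the absence of paradoxical decompositions\<close>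

text \<open>\<open>F\<close> has the lit lamps and the lamplighter in \<open>{0..N}\<close>;
  \<open>I\<close> keeps the lamplighter at distance at least \<open>r\<close> from both ends, so a
  step from \<open>I\<close> switches only lamps in \<open>{0..N}\<close>.\<close>

lemma lamplighter_Folner:
  fixes r :: int
  assumes "r > 0"
  obtains F I where "finite F" "F \<subseteq> carrier lamplighter" "I \<subseteq> F" "2 * card (F - I) < card F"
    and "\<And>x y. x \<in> I \<Longrightarrow> y \<in> carrier lamplighter \<Longrightarrow> lamp_near r x y \<Longrightarrow> y \<in> F"
proof -
  \<comment> \<open>The two end strips hold \<open>2 * r\<close> of the \<open>4 * r + 1\<close>
    positions, just under half.\<close>
  define N where "N = 4 * r"
  define E where "E = {f :: int \<Rightarrow> int. (\<forall>i. f i \<in> {0, 1}) \<and> (\<forall>i. i \<notin> {0..N} \<longrightarrow> f i = 0)}"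
  have "E \<subseteq> (\<lambda>A i. if i \<in> A then 1 else 0) ` Pow {0..N}"
  proof
    fix f assume f: "f \<in> E"
    then have "{i. f i = 1} \<in> Pow {0..N}" by (auto simp: E_def)
    moreover have "f = (\<lambda>i. if i \<in> {i. f i = 1} then 1 else 0)"
    proof
      show "f i = (if i \<in> {i. f i = 1} then 1 else 0)" for i
        using f by (auto simp: E_def)
    qed
    ultimately show "f \<in> (\<lambda>A i. if i \<in> A then 1 else 0) ` Pow {0..N}" by (rule rev_image_eqI)
  qed
  then have "finite E" by (rule finite_subset) simp
  moreover have "(\<lambda>i. 0) \<in> E" by (simp add: E_def)
  ultimately have "card E > 0" by (auto simp: card_gt_0_iff)
  show ?thesis
  proof (rule that[of "E \<times> {0..N}" "E \<times> {r..N - r}"])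
    show "E \<times> {0..N} \<subseteq> carrier lamplighter"
    proof
      fix x assume "x \<in> E \<times> {0..N}"
      then obtain f k where x: "x = (f, k)" "f \<in> E" by blast
      then have "{i. f i \<noteq> 0} \<subseteq> {0..N}" by (auto simp: E_def)
      then show "x \<in> carrier lamplighter"
        using x finite_subset by (auto simp: mem_carrier_lamplighter E_def)
    qed
    show "E \<times> {r..N - r} \<subseteq> E \<times> {0..N}" using assms by auto
    have "E \<times> {0..N} - E \<times> {r..N - r} = E \<times> ({0..<r} \<union> {N - r<..N})"
      using assms by (auto simp: N_def)
    moreover have "card ({0..<r} \<union> {N - r<..N}) = nat (2 * r)"
      using assms by (subst card_Un_disjoint) (auto simp: N_def)
    ultimately show "2 * card (E \<times> {0..N} - E \<times> {r..N - r}) < card (E \<times> {0..N})"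
      using \<open>card E > 0\<close> assms by (simp add: card_cartesian_product N_def)
    show "y \<in> E \<times> {0..N}"
      if "x \<in> E \<times> {r..N - r}" "y \<in> carrier lamplighter" "lamp_near r x y" for x y
    proof -
      obtain f j g k where xy: "x = (f, j)" "y = (g, k)" by (cases x, cases y)
      have "g i = 0" if "i \<notin> {0..N}" for i
      proof -
        have j: "r \<le> j" "j \<le> N - r" and f: "f i = 0"
          using \<open>x \<in> E \<times> {r..N - r}\<close> \<open>i \<notin> {0..N}\<close> unfolding xy E_def by auto
        have "i < 0 \<or> i > N" using \<open>i \<notin> {0..N}\<close> by auto
        then have "\<bar>i - j\<bar> > r" using j by linarith
        then show ?thesis using f \<open>lamp_near r x y\<close> by (simp add: lamp_near_def xy)
      qed
      then show ?thesis using that by (auto simp: xy lamp_near_def E_def mem_carrier_lamplighter)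
    qed
  qed (use \<open>finite E\<close> in simp)
qed

text \<open>If both pairs covered the group, each would fill \<open>F\<close> up to the error
  \<open>card (F - I)\<close>. As the four sets are disjoint, adding the two counts gives
  \<open>2 * card F \<le> card F + 2 * card (F - I)\<close>, against the choice of
  \<open>F\<close>.\<close>

lemma lamplighter_not_paradoxical:
  assumes "r > 0"
    and u: "inj_on u (carrier lamplighter)" "u ` carrier lamplighter \<subseteq> carrier lamplighter"
      "\<And>x. x \<in> carrier lamplighter \<Longrightarrow> lamp_near r x (u x)"
    and v: "inj_on v (carrier lamplighter)" "v ` carrier lamplighter \<subseteq> carrier lamplighter"
      "\<And>x. x \<in> carrier lamplighter \<Longrightarrow> lamp_near r x (v x)"
    and disj: "X1 \<inter> X2 = {}" "X3 \<inter> X4 = {}" "(X1 \<union> X2) \<inter> (X3 \<union> X4) = {}"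
  shows "\<exists>x\<in>carrier lamplighter. x \<notin> X1 \<and> u x \<notin> X2 \<or> x \<notin> X3 \<and> v x \<notin> X4"
proof (rule ccontr)
  assume "\<not> ?thesis"
  then have cover: "x \<in> X1 \<or> u x \<in> X2" "x \<in> X3 \<or> v x \<in> X4" if "x \<in> carrier lamplighter" for x
    using that by blast+
  obtain F I where F: "finite F" "F \<subseteq> carrier lamplighter" "I \<subseteq> F" "2 * card (F - I) < card F"
    "\<And>x y. x \<in> I \<Longrightarrow> y \<in> carrier lamplighter \<Longrightarrow> lamp_near r x y \<Longrightarrow> y \<in> F"
    using lamplighter_Folner[OF assms(1)] by metis
  \<comment> \<open>A point of \<open>I\<close> outside \<open>A\<close> is sent by \<open>w\<close>
    into \<open>B\<close> without leaving \<open>F\<close>, and injectivity lets these points be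
    counted inside \<open>F \<inter> B\<close>.\<close>
  have count: "card F \<le> card (F \<inter> A) + card (F \<inter> B) + card (F - I)"
    if w: "inj_on w (carrier lamplighter)" "w ` carrier lamplighter \<subseteq> carrier lamplighter"
      "\<And>x. x \<in> carrier lamplighter \<Longrightarrow> lamp_near r x (w x)"
      and c: "\<And>x. x \<in> carrier lamplighter \<Longrightarrow> x \<in> A \<or> w x \<in> B" for w A B
  proof -
    define D where "D = {x \<in> I. w x \<in> B}"
    have "D \<subseteq> F" using F(3) by (auto simp: D_def)
    have "F \<subseteq> (F \<inter> A) \<union> D \<union> (F - I)" using c F(2) by (auto simp: D_def)
    then have "card F \<le> card ((F \<inter> A) \<union> D \<union> (F - I))"
      using F(1) \<open>D \<subseteq> F\<close> by (intro card_mono) (auto intro: finite_subset)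
    also have "\<dots> \<le> card (F \<inter> A) + card D + card (F - I)"
      by (meson add_le_mono1 card_Un_le order_trans)
    also have "card D \<le> card (F \<inter> B)"
    proof (rule card_inj_on_le)
      show "inj_on w D" using w(1) \<open>D \<subseteq> F\<close> F(2) by (meson inj_on_subset)
      show "w ` D \<subseteq> F \<inter> B"
      proof
        fix y assume "y \<in> w ` D"
        then obtain x where x: "y = w x" "x \<in> I" "w x \<in> B" by (auto simp: D_def)
        then have "x \<in> carrier lamplighter" using F(2,3) by blast
        then show "y \<in> F \<inter> B" using F(5)[OF x(2)] w(2,3) x by blast
      qed
    qed (use F(1) in simp)
    finally show ?thesis by simp
  qed
  have "card (F \<inter> X1) + card (F \<inter> X2) + (card (F \<inter> X3) + card (F \<inter> X4))
      = card (F \<inter> X1 \<union> F \<inter> X2) + card (F \<inter> X3 \<union> F \<inter> X4)"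
    using disj F(1) by (subst (1 2) card_Un_disjoint) auto
  also have "\<dots> = card ((F \<inter> X1 \<union> F \<inter> X2) \<union> (F \<inter> X3 \<union> F \<inter> X4))"
    using disj F(1) by (subst card_Un_disjoint) auto
  also have "\<dots> \<le> card F" using F(1) by (intro card_mono) auto
  finally show False
    using count[OF u cover(1)] count[OF v cover(2)] F(4) by linarith
qed

section \<open>Crossings of two-coloured grids\<close>

text \<open>Diagonal neighbours have to count: with horizontal and vertical ones alone, a chessboard
  colouring of a large grid has no monochromatic crossing.\<close>

definition king_adj :: "nat \<times> nat \<Rightarrow> nat \<times> nat \<Rightarrow> bool"
  where "king_adj p q \<longleftrightarrow> fst p \<le> Suc (fst q) \<and> fst q \<le> Suc (fst p) \<and>
    snd p \<le> Suc (snd q) \<and> snd q \<le> Suc (snd p)"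

text \<open>A step raises \<open>f\<close> by at most one, so no value is skipped on the way up.
  This locates prescribed columns or rows on a crossing.\<close>

lemma rtrancl_intermediate_value:
  fixes f :: "'a \<Rightarrow> nat"
  assumes "(p, q) \<in> E\<^sup>*" and "\<And>a b. (a, b) \<in> E \<Longrightarrow> f b \<le> Suc (f a)"
    and "f p \<le> v" "v \<le> f q"
  shows "\<exists>r. (p, r) \<in> E\<^sup>* \<and> f r = v"
  using assms(1,4)
proof (induction rule: rtrancl_induct)
  case base
  then show ?case using assms(3) by auto
next
  case (step y z)
  show ?case
  proof (cases "v \<le> f y")
    case False
    then have "f z = v" using step.prems assms(2)[OF step.hyps(2)] by simp
    moreover have "(p, z) \<in> E\<^sup>*" using step.hyps by (rule rtrancl_into_rtrancl)
    ultimately show ?thesis by blast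
  qed (rule step.IH)
qed

definition mono_steps :: "(nat \<times> nat) set \<Rightarrow> (nat \<times> nat \<Rightarrow> bool) \<Rightarrow> ((nat \<times> nat) \<times> (nat \<times> nat)) set"
  where "mono_steps P c = {(p, q). p \<in> P \<and> q \<in> P \<and> c p = c q \<and> king_adj p q}"

text \<open>A form of the Hex theorem. Already the joint absence of a \<open>True\<close> chain from
  left to right and of a \<open>False\<close> chain from bottom to top is contradictory; the colour
  is left open because later only monochromaticity matters.\<close>

lemma grid_crossing:
  fixes c :: "nat \<times> nat \<Rightarrow> bool" and M k :: nat
  assumes "M > 0" "k > 0"
  defines "P \<equiv> {1..M} \<times> {1..k}"
  shows "\<exists>p q. p \<in> P \<and> (p, q) \<in> (mono_steps P c)\<^sup>* \<and>
    (fst p = 1 \<and> fst q = M \<or> snd p = 1 \<and> snd q = k)"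
proof (rule ccontr)
  let ?E = "mono_steps P c"
  assume no: "\<nexists>p q. p \<in> P \<and> (p, q) \<in> ?E\<^sup>* \<and> (fst p = 1 \<and> fst q = M \<or> snd p = 1 \<and> snd q = k)"
  define A where "A = {q \<in> P. c q \<and> (\<exists>p\<in>P. fst p = 1 \<and> (p, q) \<in> ?E\<^sup>*)}"
  define B where "B = {q \<in> P. \<not> c q \<and> (\<exists>p\<in>P. snd p = 1 \<and> (p, q) \<in> ?E\<^sup>*)}"
  have A_left: "p \<in> A" if "p \<in> P" "c p" "fst p = 1" for p
    using that unfolding A_def by blast
  have A_step: "q \<in> A" if "p \<in> A" "q \<in> P" "c q" "king_adj p q" for p q
  proof -
    have "(p, q) \<in> ?E" using that by (simp add: A_def mono_steps_def)
    then show ?thesis using that unfolding A_def by (auto intro: rtrancl_into_rtrancl)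
  qed
  have A_right: "fst p < M" if "p \<in> A" for p
  proof -
    have "fst p \<noteq> M" using that no unfolding A_def by blast
    moreover have "fst p \<le> M" using that unfolding A_def P_def by auto
    ultimately show ?thesis by simp
  qed
  have B_bot: "p \<in> B" if "p \<in> P" "\<not> c p" "snd p = 1" for p
    using that unfolding B_def by blast
  have B_step: "q \<in> B" if "p \<in> B" "q \<in> P" "\<not> c q" "king_adj p q" for p q
  proof -
    have "(p, q) \<in> ?E" using that by (simp add: B_def mono_steps_def)
    then show ?thesis using that unfolding B_def by (auto intro: rtrancl_into_rtrancl)
  qed
  have B_top: "snd p < k" if "p \<in> B" for p
  proof -
    have "snd p \<noteq> k" using that no unfolding B_def by blast
    moreover have "snd p \<le> k" using that unfolding B_def P_def by auto
    ultimately show ?thesis by simp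
  qed
  \<comment> \<open>Suppose that nothing crosses, so \<open>A\<close> misses the right side and \<open>B\<close> the top. The grid is
    surrounded by a ring whose left, bottom, right and top sides count as \<open>A\<close>, as \<open>B\<close>, as the points of
    colour \<open>True\<close> outside \<open>A\<close>, and as those of colour \<open>False\<close> outside \<open>B\<close>. These four classes get the
    labels \<open>(0, 0)\<close>, \<open>(1, 0)\<close>, \<open>(1, 1)\<close> and \<open>(0, 1)\<close>. Opposite labels are never adjacent, whereas
    Kuhn's lemma yields a cell on which neither label coordinate is constant.\<close>
  define lab :: "nat \<times> nat \<Rightarrow> nat \<times> nat" where "lab = (\<lambda>(x, y).
    if x = 0 then (if y > k then (0, 1) else (0, 0))
    else if x > M then (if y = 0 then (1, 0) else (1, 1))
    else if y = 0 then (1, 0)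
    else if y > k then (0, 1)
    else if c (x, y) then (if (x, y) \<in> A then (0, 0) else (1, 1))
    else if (x, y) \<in> B then (1, 0) else (0, 1))"
  have lab00: "fst u = 0 \<and> snd u \<le> k \<or> u \<in> A" if "lab u = (0, 0)" for u
    using that by (cases u) (auto simp: lab_def split: if_splits)
  have lab11: "fst u > M \<or> u \<in> P \<and> c u \<and> u \<notin> A" if "lab u = (1, 1)" for u
    using that by (cases u) (auto simp: lab_def P_def split: if_splits)
  have lab10: "snd u = 0 \<or> u \<in> B" if "lab u = (1, 0)" for u
    using that by (cases u) (auto simp: lab_def split: if_splits)
  have lab01: "snd u > k \<or> u \<in> P \<and> \<not> c u \<and> u \<notin> B" if "lab u = (0, 1)" for u
    using that by (cases u) (auto simp: lab_def P_def split: if_splits)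
  \<comment> \<open>A \<open>True\<close> point adjacent to \<open>A\<close> belongs to
    \<open>A\<close>, and a point of the left side of the ring has only the first column of the grid
    within reach, whose \<open>True\<close> points lie in \<open>A\<close>. The other opposite pair
    is treated in the same way with \<open>B\<close>.\<close>
  have opp1: False if uv: "king_adj u v" and u: "lab u = (0, 0)" and v: "lab v = (1, 1)" for u v
    using lab00[OF u]
  proof
    assume u0: "fst u = 0 \<and> snd u \<le> k"
    then have "fst v \<le> 1" using uv by (simp add: king_adj_def)
    then have "v \<in> P" "c v" "v \<notin> A" using lab11[OF v] \<open>M > 0\<close> by auto
    moreover from this have "fst v = 1" using \<open>fst v \<le> 1\<close> by (auto simp: P_def)
    ultimately show False using A_left by blast
  next
    assume "u \<in> A"
    moreover from A_right[OF this] have "fst v \<le> M" using uv by (simp add: king_adj_def)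
    ultimately show False using lab11[OF v] A_step[of u v] uv by auto
  qed
  have opp2: False if uv: "king_adj u v" and u: "lab u = (1, 0)" and v: "lab v = (0, 1)" for u v
    using lab10[OF u]
  proof
    assume u0: "snd u = 0"
    then have "snd v \<le> 1" using uv by (simp add: king_adj_def)
    then have "v \<in> P" "\<not> c v" "v \<notin> B" using lab01[OF v] \<open>k > 0\<close> by auto
    moreover from this have "snd v = 1" using \<open>snd v \<le> 1\<close> by (auto simp: P_def)
    ultimately show False using B_bot by blast
  next
    assume "u \<in> B"
    moreover from B_top[OF this] have "snd v \<le> k" using uv by (simp add: king_adj_def)
    ultimately show False using lab01[OF v] B_step[of u v] uv by auto
  qed
  \<comment> \<open>Kuhn's lemma works on a square \<open>{0..p}\<close> in each direction. Any
    \<open>p\<close> exceeding both \<open>M\<close> and \<open>k\<close> will do, since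
    \<open>lab\<close> extends the right and top sides of the ring indefinitely.\<close>
  define p where "p = M + k + 1"
  define coord where "coord u i = (if i = 0 then fst u else snd u)" for u :: "nat \<times> nat" and i :: nat
  define label where "label z = coord (lab (z 0, z 1))" for z :: "nat \<Rightarrow> nat"
  have lab_vals: "lab u \<in> {0, 1} \<times> {0, 1}" for u
    by (cases u) (simp add: lab_def)
  have less2: "(\<forall>i<2. Q i) \<longleftrightarrow> Q 0 \<and> Q 1" for Q :: "nat \<Rightarrow> bool"
    by (auto simp: less_2_cases_iff)
  obtain q where q: "\<forall>i<2. \<exists>r s. (\<forall>j<2. q j \<le> r j \<and> r j \<le> q j + 1) \<and>
      (\<forall>j<2. q j \<le> s j \<and> s j \<le> q j + 1) \<and> label r i \<noteq> label s i"
  proof (rule kuhn_lemma[of p 2 label])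
    show "0 < p" by (simp add: p_def)
    show "\<forall>x. (\<forall>i<2. x i \<le> p) \<longrightarrow> (\<forall>i<2. label x i = 0 \<or> label x i = 1)"
    proof (intro allI impI)
      fix x i
      show "label x i = 0 \<or> label x i = 1"
        using lab_vals[of "(x 0, x 1)"] by (auto simp: label_def coord_def mem_Times_iff)
    qed
    show "\<forall>x. (\<forall>i<2. x i \<le> p) \<longrightarrow> (\<forall>i<2. x i = 0 \<longrightarrow> label x i = 0)"
      unfolding less2 by (auto simp: label_def coord_def lab_def)
    show "\<forall>x. (\<forall>i<2. x i \<le> p) \<longrightarrow> (\<forall>i<2. x i = p \<longrightarrow> label x i = 1)"
      unfolding less2 by (auto simp: label_def coord_def lab_def p_def)
  qed
  define C where "C = {u. q 0 \<le> fst u \<and> fst u \<le> q 0 + 1 \<and> q 1 \<le> snd u \<and> snd u \<le> q 1 + 1}"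
  have C_adj: "king_adj u v" if "u \<in> C" "v \<in> C" for u v
    using that by (auto simp: C_def king_adj_def)
  have cell: "\<exists>u\<in>C. \<exists>v\<in>C. coord (lab u) i \<noteq> coord (lab v) i"
    if "i < 2" for i
  proof -
    obtain r s where rs: "\<forall>j<2. q j \<le> r j \<and> r j \<le> q j + 1" "\<forall>j<2. q j \<le> s j \<and> s j \<le> q j + 1"
      "label r i \<noteq> label s i"
      using q \<open>i < 2\<close> by blast
    then have "(r 0, r 1) \<in> C" "(s 0, s 1) \<in> C"
      unfolding less2 by (simp_all add: C_def)
    with rs(3) show ?thesis
      unfolding label_def by blast
  qed
  have ex0: "\<exists>u\<in>C. \<exists>v\<in>C. fst (lab u) \<noteq> fst (lab v)"
    using cell[of 0] by (simp add: coord_def)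
  have ex1: "\<exists>u\<in>C. \<exists>v\<in>C. snd (lab u) \<noteq> snd (lab v)"
    using cell[of 1] by (simp add: coord_def)
  \<comment> \<open>Points of a cell are mutually adjacent, so its labels contain no diagonal pair
    of the unit square. They then lie on one edge of that square, where some coordinate is
    constant.\<close>
  have no1: "\<not> ((0, 0) \<in> lab ` C \<and> (1, 1) \<in> lab ` C)"
    using opp1 C_adj by (metis imageE)
  have no2: "\<not> ((1, 0) \<in> lab ` C \<and> (0, 1) \<in> lab ` C)"
    using opp2 C_adj by (metis imageE)
  have sub: "lab ` C \<subseteq> {(0, 0), (0, 1), (1, 0), (1, 1)}"
  proof
    fix a assume "a \<in> lab ` C"
    then obtain u where "a = lab u" by blast
    then show "a \<in> {(0, 0), (0, 1), (1, 0), (1, 1)}"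
      using lab_vals[of u] by (cases a) (auto simp: mem_Times_iff)
  qed
  have split: "(\<exists>u\<in>C. g u = 0) \<and> (\<exists>u\<in>C. g u = 1)"
    if "\<exists>u\<in>C. \<exists>v\<in>C. g u \<noteq> g v" "\<And>u. g u = 0 \<or> g u = 1" for g :: "nat \<times> nat \<Rightarrow> nat"
    using that by metis
  have lab_cases: "fst (lab u) = 0 \<or> fst (lab u) = 1" "snd (lab u) = 0 \<or> snd (lab u) = 1" for u
    using lab_vals[of u] by (auto simp: mem_Times_iff)
  obtain a b where ab: "a \<in> lab ` C" "fst a = 0" "b \<in> lab ` C" "fst b = 1"
    using split[OF ex0 lab_cases(1)] by blast
  obtain c d where cd: "c \<in> lab ` C" "snd c = 0" "d \<in> lab ` C" "snd d = 1"
    using split[OF ex1 lab_cases(2)] by blast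
  have "a = (0, 0) \<or> a = (0, 1)" "b = (1, 0) \<or> b = (1, 1)"
    "c = (0, 0) \<or> c = (1, 0)" "d = (0, 1) \<or> d = (1, 1)"
    using subsetD[OF sub ab(1)] subsetD[OF sub ab(3)] subsetD[OF sub cd(1)] subsetD[OF sub cd(3)] ab cd
    by auto
  then show False
    using no1 no2 ab(1,3) cd(1,3) by (elim disjE) simp_all
qed

section \<open>Translation-like actions on the lamplighter group\<close>

lemma translation_like_near:
  assumes T: "finite T" "symmetric_generating_set lamplighter T"
    and act: "translation_like_action H (carrier lamplighter) (word_metric lamplighter T) act"
    and D: "finite D" "D \<subseteq> carrier H"
  obtains r where "r > 0"
    and "\<And>h x. h \<in> D \<Longrightarrow> x \<in> carrier lamplighter \<Longrightarrow> lamp_near r x (act h x)"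
proof -
  interpret L: group lamplighter by (rule group_lamplighter)
  interpret group_action H "carrier lamplighter" act
    using act unfolding translation_like_action_def by blast
  define S where "S = (\<Union>h\<in>D. {inv\<^bsub>lamplighter\<^esub> x \<otimes>\<^bsub>lamplighter\<^esub> act h x |x. x \<in> carrier lamplighter})"
  have closed: "act h ` carrier lamplighter \<subseteq> carrier lamplighter" if "h \<in> D" for h
    using surj_prop that D(2) by blast
  have "finite {inv\<^bsub>lamplighter\<^esub> x \<otimes>\<^bsub>lamplighter\<^esub> act h x |x. x \<in> carrier lamplighter}"
    if "h \<in> D" for h
    using act that D(2) finite_displacements[OF group_lamplighter T(2,1) _ closed[OF that]]
    unfolding translation_like_action_def by blast
  then have "finite S"
    using D(1) unfolding S_def by blast
  moreover have "S \<subseteq> carrier lamplighter"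
    using closed by (auto simp: S_def image_subset_iff)
  ultimately obtain r where r: "\<And>x y. x \<in> carrier lamplighter \<Longrightarrow> y \<in> carrier lamplighter \<Longrightarrow>
      inv\<^bsub>lamplighter\<^esub> x \<otimes>\<^bsub>lamplighter\<^esub> y \<in> S \<Longrightarrow> lamp_near r x y" "r > 0"
    using finite_lamp_near by metis
  show ?thesis
  proof (rule that[OF r(2)])
    fix h x assume h: "h \<in> D" and x: "x \<in> carrier lamplighter"
    show "lamp_near r x (act h x)"
    proof (rule r(1)[OF x])
      show "act h x \<in> carrier lamplighter" using closed[OF h] x by blast
      show "inv\<^bsub>lamplighter\<^esub> x \<otimes>\<^bsub>lamplighter\<^esub> act h x \<in> S" using h x unfolding S_def by blast
    qed
  qed
qed

text \<open>By freeness each orbit is a copy of \<open>H\<close>: \<open>el x\<close> is the only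
  group element carrying the chosen representative to \<open>x\<close>. Orbitwise, any other action
  of \<open>H\<close> can therefore receive an equivariant map.\<close>

lemma free_action_equivariant_map:
  fixes \<phi> :: "'h \<Rightarrow> 'w \<Rightarrow> 'w"
  assumes "group_action H M act"
    and free: "\<And>h x. h \<in> carrier H \<Longrightarrow> x \<in> M \<Longrightarrow> act h x = x \<Longrightarrow> h = \<one>\<^bsub>H\<^esub>"
    and \<phi>: "\<And>g h. g \<in> carrier H \<Longrightarrow> h \<in> carrier H \<Longrightarrow> \<phi> (g \<otimes>\<^bsub>H\<^esub> h) = \<phi> g \<circ> \<phi> h"
  obtains \<pi> where "\<And>g x. g \<in> carrier H \<Longrightarrow> x \<in> M \<Longrightarrow> \<pi> (act g x) = \<phi> g (\<pi> x)"
proof -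
  interpret group_action H M act by fact
  interpret H: group H using group_hom group_hom.axioms(1) by blast
  \<comment> \<open>The choice depends only on the orbit as a set, so equality of orbits suffices to
    show that \<open>rep\<close> is constant on them.\<close>
  define rep where "rep x = (SOME y. y \<in> orbit H act x)" for x
  define el where "el x = (SOME h. h \<in> carrier H \<and> act h (rep x) = x)" for x
  have rep: "rep x \<in> orbit H act x" if "x \<in> M" for x
    unfolding rep_def using orbit_refl[OF that] by (rule someI)
  have orbit_M: "y \<in> M" if y: "y \<in> orbit H act x" and x: "x \<in> M" for x y
  proof -
    from y obtain g where g: "g \<in> carrier H" "y = act g x" unfolding orbit_def by blast
    show ?thesis using element_image[OF g(1) x g(2)[symmetric]] .
  qed
  have rep_M: "rep x \<in> M" if "x \<in> M" for x
    using orbit_M[OF rep[OF that] that] .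
  have el: "el x \<in> carrier H \<and> act (el x) (rep x) = x" if "x \<in> M" for x
  proof -
    have "x \<in> orbit H act (rep x)"
      using orbit_sym[OF that rep_M[OF that] rep[OF that]] .
    then have "\<exists>h. h \<in> carrier H \<and> act h (rep x) = x" by (auto simp: orbit_def)
    then show ?thesis unfolding el_def by (rule someI_ex)
  qed
  have eq: "g = h" if "g \<in> carrier H" "h \<in> carrier H" "x \<in> M" "act g x = act h x" for g h x
  proof -
    have "act (inv\<^bsub>H\<^esub> h \<otimes>\<^bsub>H\<^esub> g) x = act (inv\<^bsub>H\<^esub> h) (act h x)"
      using that composition_rule[of x "inv\<^bsub>H\<^esub> h" g] by simp
    also have "\<dots> = x" using that orbit_sym_aux[of h x] by simp
    finally have "inv\<^bsub>H\<^esub> h \<otimes>\<^bsub>H\<^esub> g = \<one>\<^bsub>H\<^esub>"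
      using free[of "inv\<^bsub>H\<^esub> h \<otimes>\<^bsub>H\<^esub> g" x] that(1-3) by simp
    moreover have "g = h \<otimes>\<^bsub>H\<^esub> (inv\<^bsub>H\<^esub> h \<otimes>\<^bsub>H\<^esub> g)"
      using that(1,2) by (simp flip: H.m_assoc)
    ultimately show ?thesis using that(2) by simp
  qed
  have rep_act: "rep (act g x) = rep x" if g: "g \<in> carrier H" and x: "x \<in> M" for g x
  proof -
    have gx: "act g x \<in> M" "act g x \<in> orbit H act x"
      using element_image[OF g x HOL.refl] g unfolding orbit_def by blast+
    have "y \<in> orbit H act (act g x) \<longleftrightarrow> y \<in> orbit H act x" for y
    proof
      assume y: "y \<in> orbit H act (act g x)"
      then have "y \<in> M" using gx(1) by (rule orbit_M)
      then show "y \<in> orbit H act x" using orbit_trans[OF x gx(1) _ gx(2) y] by blast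
    next
      assume y: "y \<in> orbit H act x"
      then have "y \<in> M" using x by (rule orbit_M)
      then show "y \<in> orbit H act (act g x)"
        using orbit_trans[OF gx(1) x _ orbit_sym[OF x gx] y] by blast
    qed
    then show ?thesis by (simp add: rep_def)
  qed
  show ?thesis
  \<comment> \<open>Here \<open>undefined\<close> is an arbitrary base point; on each orbit the map
    follows the action on this point.\<close>
  proof (rule that[of "\<lambda>x. \<phi> (el x) undefined"])
    fix g x assume g: "g \<in> carrier H" and x: "x \<in> M"
    have gx: "act g x \<in> M" by (rule element_image[OF g x HOL.refl])
    have "act (el (act g x)) (rep x) = act (g \<otimes>\<^bsub>H\<^esub> el x) (rep x)"
      using el[OF gx] el[OF x] rep_act[OF g x] composition_rule[OF rep_M[OF x] g] by simp
    then have "el (act g x) = g \<otimes>\<^bsub>H\<^esub> el x"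
      using el[OF gx] el[OF x] g rep_M[OF x] eq by blast
    then show "\<phi> (el (act g x)) undefined = \<phi> g (\<phi> (el x) undefined)"
      using \<phi> g el[OF x] by simp
  qed
qed

text \<open>Preimages under the equivariant map would turn a paradoxical decomposition of any
  \<open>H\<close>-set into one of the lamplighter group whose maps \<open>act a\<close> and
  \<open>act b\<close> have bounded displacement.\<close>

lemma no_translation_like_action_paradoxical:
  fixes \<phi> :: "'h \<Rightarrow> 'w \<Rightarrow> 'w"
  assumes T: "finite T" "symmetric_generating_set lamplighter T"
    and act: "translation_like_action H (carrier lamplighter) (word_metric lamplighter T) act"
    and \<phi>: "\<And>g h. g \<in> carrier H \<Longrightarrow> h \<in> carrier H \<Longrightarrow> \<phi> (g \<otimes>\<^bsub>H\<^esub> h) = \<phi> g \<circ> \<phi> h"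
    and ab: "a \<in> carrier H" "b \<in> carrier H"
    and disj: "U1 \<inter> U2 = {}" "U3 \<inter> U4 = {}" "(U1 \<union> U2) \<inter> (U3 \<union> U4) = {}"
  shows "\<exists>z. z \<notin> U1 \<and> \<phi> a z \<notin> U2 \<or> z \<notin> U3 \<and> \<phi> b z \<notin> U4"
proof -
  interpret group_action H "carrier lamplighter" act
    using act unfolding translation_like_action_def by blast
  obtain r where r: "r > 0"
    "\<And>h x. h \<in> {a, b} \<Longrightarrow> x \<in> carrier lamplighter \<Longrightarrow> lamp_near r x (act h x)"
    using translation_like_near[OF T act, of "{a, b}"] ab by auto
  have free: "h = \<one>\<^bsub>H\<^esub>" if "h \<in> carrier H" "x \<in> carrier lamplighter" "act h x = x" for h x
    using act that unfolding translation_like_action_def by blast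
  obtain \<pi> where \<pi>: "\<And>g x. g \<in> carrier H \<Longrightarrow> x \<in> carrier lamplighter \<Longrightarrow> \<pi> (act g x) = \<phi> g (\<pi> x)"
  proof (rule free_action_equivariant_map[OF group_action_axioms, of \<phi>])
    show "h = \<one>\<^bsub>H\<^esub>" if "h \<in> carrier H" "x \<in> carrier lamplighter" "act h x = x" for h x
      using that by (rule free)
    show "\<phi> (g \<otimes>\<^bsub>H\<^esub> h) = \<phi> g \<circ> \<phi> h" if "g \<in> carrier H" "h \<in> carrier H" for g h
      using that by (rule \<phi>)
  qed blast
  have "\<exists>x\<in>carrier lamplighter. x \<notin> \<pi> -` U1 \<and> act a x \<notin> \<pi> -` U2 \<or> x \<notin> \<pi> -` U3 \<and> act b x \<notin> \<pi> -` U4"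
  proof (rule lamplighter_not_paradoxical[OF r(1)])
    show "inj_on (act a) (carrier lamplighter)" "inj_on (act b) (carrier lamplighter)"
      using inj_prop ab by auto
    show "act a ` carrier lamplighter \<subseteq> carrier lamplighter" "act b ` carrier lamplighter \<subseteq> carrier lamplighter"
      using surj_prop ab by auto
  qed (use disj r(2) in auto)
  then show ?thesis using \<pi> ab by auto
qed

section \<open>Baumslag--Solitar groups with a trivial exponent\<close>

lemma word_act_replicate: "word_act f (replicate k (x, b)) = f x b ^^ k"
  by (induction k) simp_all

text \<open>A bijection between the two sets is glued to one between their complements. This
  supplies the permutation by which \<open>s\<close> acts.\<close>

lemma ex_bij_image_eq:
  fixes U V :: "'a::countable set"
  assumes "infinite U" "infinite V" "infinite (- U)" "infinite (- V)"
  obtains \<sigma> where "bij \<sigma>" "\<sigma> ` U = V"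
proof -
  have ex: "\<exists>g. bij_betw g A B" if "infinite A" "infinite B" for A B :: "'a set"
    using bij_betw_trans[OF to_nat_on_infinite[OF countableI_type that(1)]
        bij_betw_from_nat_into[OF countableI_type that(2)]] by blast
  obtain g h where gh: "bij_betw g U V" "bij_betw h (- U) (- V)"
    using ex assms by meson
  define \<sigma> where "\<sigma> x = (if x \<in> U then g x else h x)" for x
  have U: "bij_betw \<sigma> U V"
    using gh(1) by (subst bij_betw_cong[of _ _ g]) (auto simp: \<sigma>_def)
  have V: "bij_betw \<sigma> (- U) (- V)"
    using gh(2) by (subst bij_betw_cong[of _ _ h]) (auto simp: \<sigma>_def)
  have "bij_betw \<sigma> (U \<union> - U) (V \<union> - V)"
    using U V by (rule bij_betw_combine) auto
  then show ?thesis
    using that[of \<sigma>] U V by (simp add: bij_betw_def)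
qed

text \<open>The levels below \<open>k\<close> are rotated and all others fixed, which gives a
  permutation for \<open>t\<close>. Its inverse is treated as well because exponents may be
  negative.\<close>

lemma ex_cyclic_permutation:
  assumes "k \<ge> (2 :: nat)"
  obtains \<tau> \<tau>' :: "nat \<times> nat \<Rightarrow> nat \<times> nat" where "\<tau> \<circ> \<tau>' = id" "\<tau>' \<circ> \<tau> = id"
    "\<tau> ^^ k = id" "\<tau>' ^^ k = id" "\<And>i. snd (\<tau> (i, 0)) \<noteq> 0"
proof -
  define \<tau> :: "nat \<times> nat \<Rightarrow> nat \<times> nat"
    where "\<tau> = (\<lambda>(i, j). (i, if j < k then (j + 1) mod k else j))"
  have pow: "(\<tau> ^^ l) (i, j) = (i, if j < k then (j + l) mod k else j)" for l i j
    by (induction l) (use assms in \<open>auto simp: \<tau>_def mod_Suc_eq\<close>)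
  have k: "\<tau> ^^ k = id"
    by (auto simp: fun_eq_iff pow)
  define \<tau>' where "\<tau>' = \<tau> ^^ (k - 1)"
  have "Suc (k - 1) = k" using assms by simp
  then have inv: "\<tau> \<circ> \<tau>' = id" "\<tau>' \<circ> \<tau> = id"
    using k funpow_Suc_right[of "k - 1" \<tau>] by (metis \<tau>'_def funpow.simps(2), metis \<tau>'_def)
  have "\<tau>' ^^ k = (\<tau> ^^ k) ^^ (k - 1)"
    by (simp add: \<tau>'_def funpow_mult mult.commute)
  then have "\<tau>' ^^ k = id" by (simp add: k)
  moreover have "snd (\<tau> (i, 0)) \<noteq> 0" for i
    using assms by (simp add: \<tau>_def)
  ultimately show ?thesis using that inv k by blast
qed

text \<open>Ping-pong on \<open>nat \<times> nat\<close>: \<open>t\<close> acts with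
  \<open>t^k = 1\<close>, which makes both sides of the relation trivial, so \<open>s\<close> may
  act by any permutation.\<close>

lemma no_translation_like_action_degenerate:
  assumes nondegenerate: "{\<bar>m\<bar>, \<bar>n\<bar>} \<noteq> {0, 1}" and "m = 0 \<or> n = 0"
    and T: "finite T" "symmetric_generating_set lamplighter T"
  shows "\<not> translation_like_action (baumslag_solitar m n)
    (carrier lamplighter) (word_metric lamplighter T) act"
proof
  assume act: "translation_like_action (baumslag_solitar m n)
    (carrier lamplighter) (word_metric lamplighter T) act"
  \<comment> \<open>If both exponents vanish, then \<open>t\<close> is free and may act with any order.\<close>
  define k where "k = (if m = 0 \<and> n = 0 then 2 else nat (\<bar>m\<bar> + \<bar>n\<bar>))"
  have "\<bar>m\<bar> + \<bar>n\<bar> \<noteq> 1"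
  proof
    assume "\<bar>m\<bar> + \<bar>n\<bar> = 1"
    then have "{\<bar>m\<bar>, \<bar>n\<bar>} = {0, 1}" using \<open>m = 0 \<or> n = 0\<close> by auto
    with nondegenerate show False by contradiction
  qed
  then have "k \<ge> 2" using \<open>m = 0 \<or> n = 0\<close> by (auto simp: k_def)
  obtain \<tau> \<tau>' :: "nat \<times> nat \<Rightarrow> nat \<times> nat" where \<tau>: "\<tau> \<circ> \<tau>' = id" "\<tau>' \<circ> \<tau> = id"
    "\<tau> ^^ k = id" "\<tau>' ^^ k = id" "\<And>i. snd (\<tau> (i, 0)) \<noteq> 0"
    using ex_cyclic_permutation[OF \<open>k \<ge> 2\<close>] by metis
  \<comment> \<open>These are the two halves of level \<open>0\<close>, a level which
    \<open>\<tau>\<close> moves off itself. The permutation \<open>\<sigma>\<close> is chosen so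
    that its inverse throws everything outside \<open>Up\<close> into \<open>Um\<close>.\<close>
  define Up Um :: "(nat \<times> nat) set"
    where "Up = {z. even (fst z) \<and> snd z = 0}" and "Um = {z. odd (fst z) \<and> snd z = 0}"
  have inf: "infinite A" if sub: "range (\<lambda>i. (2 * i + c, d)) \<subseteq> A"
    for c d :: nat and A :: "(nat \<times> nat) set"
  proof -
    have "inj (\<lambda>i :: nat. (2 * i + c, d))" by (simp add: inj_on_def)
    then show ?thesis
      using sub finite_subset range_inj_infinite by blast
  qed
  obtain \<sigma> where \<sigma>: "bij \<sigma>" "\<sigma> ` Um = - Up"
  proof (rule ex_bij_image_eq[of Um "- Up"])
    show "infinite Um" by (rule inf[of 1 0]) (auto simp: Um_def)
    show "infinite (- Up)" by (rule inf[of 0 1]) (auto simp: Up_def)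
    show "infinite (- Um)" by (rule inf[of 0 1]) (auto simp: Um_def)
    show "infinite (- (- Up))" by (rule inf[of 0 0]) (auto simp: Up_def)
  qed (use that in blast)
  define f where "f x b = (case x of Gen_s \<Rightarrow> if b then \<sigma> else inv_into UNIV \<sigma> | Gen_t \<Rightarrow> if b then \<tau> else \<tau>')"
    for x b
  have f_cancel: "f x b (f x (\<not> b) z) = z" for x b z
    using \<sigma>(1) pointfree_idE[OF \<tau>(1)] pointfree_idE[OF \<tau>(2)]
    by (cases x) (auto simp: f_def bij_is_surj bij_is_inj surj_f_inv_f)
  have pow: "word_act f (word_int_pow Gen_t l) = id" if "nat \<bar>l\<bar> \<in> {0, k}" for l
  proof -
    have "f Gen_t b ^^ d = id" if "d \<in> {0, k}" for b d
      using that \<tau>(3,4) by (cases b) (auto simp: f_def)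
    from this[OF that] show ?thesis
      unfolding word_int_pow_def word_act_replicate .
  qed
  define R where "R = {([(Gen_s, True)] @ word_int_pow Gen_t m @ [(Gen_s, False)], word_int_pow Gen_t n)}"
  have "nat \<bar>m\<bar> \<in> {0, k}" "nat \<bar>n\<bar> \<in> {0, k}"
    using \<open>m = 0 \<or> n = 0\<close> by (auto simp: k_def)
  then have rel: "word_act f u = word_act f v" if "(u, v) \<in> R" for u v
    using that \<sigma>(1) by (auto simp: R_def pow f_def bij_is_surj surj_iff[symmetric])
  obtain \<phi> where \<phi>: "\<And>u. \<phi> (word_class R u) = word_act f u"
    "\<And>g h. g \<in> carrier (presented_group R) \<Longrightarrow> h \<in> carrier (presented_group R) \<Longrightarrow>
      \<phi> (g \<otimes>\<^bsub>presented_group R\<^esub> h) = \<phi> g \<circ> \<phi> h"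
    using presented_group_acts[of f R, OF f_cancel rel] by metis
  have act': "translation_like_action (presented_group R)
    (carrier lamplighter) (word_metric lamplighter T) act"
    using act by (simp add: baumslag_solitar_def R_def)
  \<comment> \<open>The elements are the inverse of \<open>s\<close> and its conjugate by
    \<open>t\<close>; the conjugate plays the same game with the sets moved by
    \<open>\<tau>\<close>.\<close>
  let ?a = "word_class R [(Gen_s, False)]"
  let ?b = "word_class R [(Gen_t, True), (Gen_s, False), (Gen_t, False)]"
  have inv_\<sigma>: "inv_into UNIV \<sigma> z \<in> Um" if "z \<notin> Up" for z
  proof -
    have "z \<in> \<sigma> ` Um" using that \<sigma>(2) by simp
    then show ?thesis using \<sigma>(1) by (auto simp: bij_is_inj)
  qed
  have "\<exists>z. z \<notin> Up \<and> \<phi> ?a z \<notin> Um \<or> z \<notin> \<tau> ` Up \<and> \<phi> ?b z \<notin> \<tau> ` Um"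
  proof (rule no_translation_like_action_paradoxical[OF T act' \<phi>(2)])
    show "?a \<in> carrier (presented_group R)" "?b \<in> carrier (presented_group R)"
      by (simp_all add: carrier_presented_group)
    show "Up \<inter> Um = {}" by (auto simp: Up_def Um_def)
    have "inj \<tau>" using \<tau>(2) by (metis inj_on_id inj_on_imageI2)
    then show "\<tau> ` Up \<inter> \<tau> ` Um = {}"
      using \<open>Up \<inter> Um = {}\<close> by (metis image_Int image_empty)
    have "z \<notin> Up \<union> Um" if "z \<in> \<tau> ` Up \<union> \<tau> ` Um" for z
    proof -
      from that obtain w where w: "z = \<tau> w" "snd w = 0"
        by (auto simp: Up_def Um_def)
      then have "snd z \<noteq> 0"
        using \<tau>(5)[of "fst w"] by (metis prod.collapse)
      then show ?thesis by (simp add: Up_def Um_def)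
    qed
    then show "(Up \<union> Um) \<inter> (\<tau> ` Up \<union> \<tau> ` Um) = {}"
      by blast
  qed
  then obtain z where "z \<notin> Up \<and> inv_into UNIV \<sigma> z \<notin> Um \<or> z \<notin> \<tau> ` Up \<and> \<tau> (inv_into UNIV \<sigma> (\<tau>' z)) \<notin> \<tau> ` Um"
    by (auto simp: \<phi> f_def)
  moreover have "\<tau>' z \<notin> Up" if "z \<notin> \<tau> ` Up"
    using that pointfree_idE[OF \<tau>(1)] by (metis imageI)
  ultimately show False using inv_\<sigma> by blast
qed

section \<open>Baumslag--Solitar groups with nonzero exponents\<close>

lemma abs_power_mult_power_le:
  fixes m n :: int
  assumes "m \<noteq> 0" "n \<noteq> 0" "y \<le> k"
  shows "\<bar>m ^ y * n ^ (k - y)\<bar> \<le> (\<bar>m\<bar> * \<bar>n\<bar>) ^ k"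
proof -
  have "\<bar>m\<bar> ^ y \<le> \<bar>m\<bar> ^ k" "\<bar>n\<bar> ^ (k - y) \<le> \<bar>n\<bar> ^ k"
    using assms by (auto intro: power_increasing)
  then show ?thesis
    by (simp add: abs_mult power_abs power_mult_distrib mult_mono)
qed

lemma div_diff_bound:
  fixes a b c :: int
  assumes "\<bar>a - b\<bar> \<le> c" "c > 0"
  shows "\<bar>a div c - b div c\<bar> \<le> 1"
proof -
  have "a \<le> b + c" "b \<le> a + c" using assms by auto
  then have "a div c \<le> (b + c) div c" "b div c \<le> (a + c) div c"
    using assms(2) by (auto intro: zdiv_mono1)
  then show ?thesis using assms(2) by (simp add: abs_le_iff)
qed

text \<open>
  Row \<open>y\<close> of the grid carries the powers \<open>t\<^sup>a\<close> with \<open>a\<close> proportional to \<open>x (m/n)\<^sup>y\<close>. Dividing by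
  \<open>\<bar>m n\<bar>\<^sup>k\<close> makes horizontal steps of length at most \<open>1\<close> in all rows \<open>y \<le> k\<close>, and the rounding
  error in vertical steps is bounded independently of \<open>k\<close>.
\<close>

definition bs_row :: "int \<Rightarrow> int \<Rightarrow> nat \<Rightarrow> nat \<Rightarrow> nat \<Rightarrow> int"
  where "bs_row m n k x y = (int x * (m ^ y * n ^ (k - y))) div (\<bar>m\<bar> * \<bar>n\<bar>) ^ k"

lemma bs_row_horizontal:
  assumes "m \<noteq> 0" "n \<noteq> 0" "y \<le> k" "x \<le> Suc x'" "x' \<le> Suc x"
  shows "\<bar>bs_row m n k x' y - bs_row m n k x y\<bar> \<le> 1"
  unfolding bs_row_def
proof (rule div_diff_bound)
  have "\<bar>int x' - int x\<bar> \<le> 1" using assms(4,5) by linarith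
  then have "\<bar>int x' - int x\<bar> * \<bar>m ^ y * n ^ (k - y)\<bar> \<le> 1 * (\<bar>m\<bar> * \<bar>n\<bar>) ^ k"
    using abs_power_mult_power_le[OF assms(1-3)] by (intro mult_mono) auto
  then show "\<bar>int x' * (m ^ y * n ^ (k - y)) - int x * (m ^ y * n ^ (k - y))\<bar> \<le> (\<bar>m\<bar> * \<bar>n\<bar>) ^ k"
    by (simp flip: left_diff_distrib add: abs_mult)
qed (use assms in simp)

text \<open>The unrounded exponents satisfy \<open>n * z' = m * z\<close> up to the shift from
  \<open>x\<close> to \<open>x'\<close>. The bound collects this shift, the two roundings by
  \<open>P\<close>, and the remainder of \<open>a\<close> modulo \<open>n\<close>, which must be
  removed before \<open>\<sigma>\<close> can pass a power of \<open>\<tau>\<close>.\<close>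

lemma bs_row_vertical:
  assumes "m \<noteq> 0" "n \<noteq> 0" "Suc y \<le> k" "x \<le> Suc x'" "x' \<le> Suc x"
  defines "a \<equiv> bs_row m n k x y"
  shows "\<bar>bs_row m n k x' (Suc y) - m * (a div n)\<bar> \<le> 2 * \<bar>m\<bar> + \<bar>n\<bar> + \<bar>m\<bar> * \<bar>n\<bar>"
proof -
  define P where "P = (\<bar>m\<bar> * \<bar>n\<bar>) ^ k"
  have "P > 0" using assms by (simp add: P_def)
  define a' where "a' = bs_row m n k x' (Suc y)"
  define z where "z = int x * (m ^ y * n ^ (k - y))"
  define z' where "z' = int x' * (m ^ Suc y * n ^ (k - Suc y))"
  have a: "a = z div P" and a': "a' = z' div P"
    by (simp_all add: a_def a'_def bs_row_def z_def z'_def P_def)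
  have ky: "k - y = Suc (k - Suc y)" using assms(3) by simp
  have "n * z' - m * z = (int x' - int x) * (m * (m ^ y * n ^ (k - y)))"
    unfolding z_def z'_def ky by (simp add: algebra_simps)
  moreover have "\<bar>(int x' - int x) * (m * (m ^ y * n ^ (k - y)))\<bar> \<le> \<bar>m\<bar> * P"
  proof -
    have "\<bar>int x' - int x\<bar> \<le> 1" using assms(4,5) by linarith
    moreover have "\<bar>m ^ y * n ^ (k - y)\<bar> \<le> P"
      unfolding P_def using assms by (intro abs_power_mult_power_le) auto
    ultimately have "\<bar>int x' - int x\<bar> * (\<bar>m\<bar> * \<bar>m ^ y * n ^ (k - y)\<bar>) \<le> 1 * (\<bar>m\<bar> * P)"
      by (intro mult_mono) auto
    then show ?thesis by (simp only: abs_mult mult_1)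
  qed
  ultimately have zz: "\<bar>n * z' - m * z\<bar> \<le> \<bar>m\<bar> * P" by simp
  have e: "\<bar>m * (z mod P)\<bar> \<le> \<bar>m\<bar> * P" "\<bar>n * (z' mod P)\<bar> \<le> \<bar>n\<bar> * P"
  proof -
    have "\<bar>w mod P\<bar> \<le> P" for w
      using pos_mod_bound[OF \<open>P > 0\<close>, of w] pos_mod_sign[OF \<open>P > 0\<close>, of w] by linarith
    then show "\<bar>m * (z mod P)\<bar> \<le> \<bar>m\<bar> * P" "\<bar>n * (z' mod P)\<bar> \<le> \<bar>n\<bar> * P"
      unfolding abs_mult by (simp_all only: mult_left_mono abs_ge_zero)
  qed
  have "(n * a' - m * a) * P = (n * z' - m * z) + m * (z mod P) - n * (z' mod P)"
    unfolding a a' by (simp add: algebra_simps flip: minus_div_mult_eq_mod)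
  then have "\<bar>(n * a' - m * a) * P\<bar> \<le> \<bar>m\<bar> * P + \<bar>m\<bar> * P + \<bar>n\<bar> * P"
    using zz e by linarith
  also have "\<dots> = (2 * \<bar>m\<bar> + \<bar>n\<bar>) * P" by (simp add: algebra_simps)
  finally have "\<bar>n * a' - m * a\<bar> * P \<le> (2 * \<bar>m\<bar> + \<bar>n\<bar>) * P"
    using \<open>P > 0\<close> by (simp add: abs_mult)
  then have 1: "\<bar>n * a' - m * a\<bar> \<le> 2 * \<bar>m\<bar> + \<bar>n\<bar>"
    using \<open>P > 0\<close> by simp
  have 2: "\<bar>m * (a mod n)\<bar> \<le> \<bar>m\<bar> * \<bar>n\<bar>"
    unfolding abs_mult using assms(2) abs_mod_less[of n a] by (intro mult_left_mono) simp_all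
  have "n * (a' - m * (a div n)) = (n * a' - m * a) + m * (a mod n)"
    by (simp add: algebra_simps flip: minus_div_mult_eq_mod)
  then have "\<bar>n\<bar> * \<bar>a' - m * (a div n)\<bar> \<le> 2 * \<bar>m\<bar> + \<bar>n\<bar> + \<bar>m\<bar> * \<bar>n\<bar>"
    using 1 2 by (simp flip: abs_mult)
  moreover have "1 * \<bar>a' - m * (a div n)\<bar> \<le> \<bar>n\<bar> * \<bar>a' - m * (a div n)\<bar>"
    using assms(2) by (intro mult_right_mono) auto
  ultimately show ?thesis by (simp add: a'_def)
qed

text \<open>In these columns the division is exact, so within one row different \<open>i\<close>
  give different exponents.\<close>

lemma bs_row_multiple:
  assumes "m \<noteq> 0" "n \<noteq> 0"
  shows "bs_row m n k (nat ((\<bar>m\<bar> * \<bar>n\<bar>) ^ k) * i) y = int i * (m ^ y * n ^ (k - y))"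
proof -
  have "int (nat ((\<bar>m\<bar> * \<bar>n\<bar>) ^ k) * i) * (m ^ y * n ^ (k - y))
      = int i * (m ^ y * n ^ (k - y)) * (\<bar>m\<bar> * \<bar>n\<bar>) ^ k"
    by (simp add: mult.assoc mult.left_commute mult.commute)
  then show ?thesis
    using assms unfolding bs_row_def by simp
qed

section \<open>Commutation and separation of powers\<close>

lemma (in group) commutation_int_pow:
  assumes "x \<in> carrier G" "y \<in> carrier G" "s \<in> carrier G" and "s \<otimes> x = y \<otimes> s"
  shows "s \<otimes> x [^] (q :: int) = y [^] q \<otimes> s"
proof -
  define h where "h z = s \<otimes> z \<otimes> inv s" for z
  have "h \<in> hom G G"
  proof (rule homI)
    fix z w assume "z \<in> carrier G" "w \<in> carrier G"
    moreover from this have "inv s \<otimes> (s \<otimes> (w \<otimes> inv s)) = w \<otimes> inv s"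
      using assms(3) by (simp flip: m_assoc)
    ultimately show "h (z \<otimes> w) = h z \<otimes> h w"
      using assms(3) by (simp add: h_def m_assoc)
  qed (use assms(3) in \<open>simp add: h_def\<close>)
  then have "h (x [^] q) = h x [^] q"
    using hom_int_pow assms(1) by (metis group_axioms)
  moreover have "h x = y"
    using assms by (simp add: h_def m_assoc)
  ultimately have "s \<otimes> x [^] q \<otimes> inv s = y [^] q"
    by (simp add: h_def)
  then show ?thesis
    using assms by (metis int_pow_closed inv_solve_right' m_closed)
qed

text \<open>With \<open>\<sigma>\<close> the inverse of \<open>s\<close>, the relation takes the
  form used for the grid. Elements are separated by an affine action on the line, \<open>t\<close>
  translating by \<open>1\<close> and \<open>s\<close> scaling by \<open>n / m\<close>, together
  with a height.\<close>

lemma baumslag_solitar_distinct_powers: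
  assumes "m \<noteq> 0" "n \<noteq> 0"
  defines "G \<equiv> baumslag_solitar m n"
  obtains \<sigma> \<tau> where "\<sigma> \<in> carrier G" "\<tau> \<in> carrier G"
    "\<sigma> \<otimes>\<^bsub>G\<^esub> \<tau> [^]\<^bsub>G\<^esub> n = \<tau> [^]\<^bsub>G\<^esub> m \<otimes>\<^bsub>G\<^esub> \<sigma>"
    "\<And>a b y z. \<tau> [^]\<^bsub>G\<^esub> (a :: int) \<otimes>\<^bsub>G\<^esub> \<sigma> [^]\<^bsub>G\<^esub> (y :: nat) = \<tau> [^]\<^bsub>G\<^esub> b \<otimes>\<^bsub>G\<^esub> \<sigma> [^]\<^bsub>G\<^esub> z \<Longrightarrow>
      a = b \<and> y = z"
proof -
  define R where "R = {([(Gen_s, True)] @ word_int_pow Gen_t m @ [(Gen_s, False)], word_int_pow Gen_t n)}"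
  have G: "G = presented_group R"
    by (simp add: G_def baumslag_solitar_def R_def)
  interpret group G
    unfolding G by (rule group_presented_group)
  define c :: real where "c = of_int n / of_int m"
  have c: "c \<noteq> 0" "c * of_int m = of_int n" using assms by (simp_all add: c_def)
  \<comment> \<open>Scaling fixes \<open>0\<close>, so only the height coordinate distinguishes the
    powers of \<open>\<sigma>\<close> at the point \<open>(0, 0)\<close>.\<close>
  define f :: "bs_gen \<Rightarrow> bool \<Rightarrow> real \<times> int \<Rightarrow> real \<times> int" where "f x b = (\<lambda>(z, h). case x of
      Gen_s \<Rightarrow> if b then (c * z, h + 1) else (z / c, h - 1)
    | Gen_t \<Rightarrow> if b then (z + 1, h) else (z - 1, h))" for x b
  have f_cancel: "f x b (f x (\<not> b) z) = z" for x b z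
    using c by (cases z; cases x) (auto simp: f_def)
  have rep_t: "word_act f (replicate l (Gen_t, b)) (z, h) = (z + (if b then real l else - real l), h)" for l b z h
    by (induction l) (simp_all add: f_def)
  have pow_t: "word_act f (word_int_pow Gen_t l) (z, h) = (z + of_int l, h)" for l z h
    by (simp add: word_int_pow_def rep_t)
  have pow_s: "word_act f (replicate l (Gen_s, False)) (0, h) = (0, h - int l)" for l h
    by (induction l) (simp_all add: f_def)
  have rel: "word_act f u = word_act f v" if "(u, v) \<in> R" for u v
    using that c by (auto simp: R_def fun_eq_iff pow_t) (auto simp: f_def pow_t distrib_left)
  obtain \<phi> where \<phi>: "\<And>u. \<phi> (word_class R u) = word_act f u"
    using presented_group_acts[of f R, OF f_cancel rel] by metis
  define \<sigma> where "\<sigma> = word_class R [(Gen_s, False)]"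
  define \<tau> where "\<tau> = word_class R [(Gen_t, True)]"
  have carr: "\<sigma> \<in> carrier G" "\<tau> \<in> carrier G"
    by (simp_all add: G carrier_presented_group \<sigma>_def \<tau>_def)
  have inv_\<sigma>: "inv\<^bsub>G\<^esub> \<sigma> = word_class R [(Gen_s, True)]"
    unfolding G \<sigma>_def using inv_word_class[of R Gen_s False] by simp
  have "word_eq R ([] @ ([(Gen_s, True)] @ word_int_pow Gen_t m @ [(Gen_s, False)]) @ []) ([] @ word_int_pow Gen_t n @ [])"
    by (rule word_eq.relation) (simp add: R_def)
  then have "word_class R ([(Gen_s, True)] @ word_int_pow Gen_t m @ [(Gen_s, False)]) = word_class R (word_int_pow Gen_t n)"
    by (simp add: word_class_eq_iff)
  then have "inv\<^bsub>G\<^esub> \<sigma> \<otimes>\<^bsub>G\<^esub> (\<tau> [^]\<^bsub>G\<^esub> m \<otimes>\<^bsub>G\<^esub> \<sigma>) = \<tau> [^]\<^bsub>G\<^esub> n"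
    unfolding inv_\<sigma> unfolding \<sigma>_def \<tau>_def G by (simp only: mult_presented_group flip: word_class_word_int_pow)
  then have comm: "\<sigma> \<otimes>\<^bsub>G\<^esub> \<tau> [^]\<^bsub>G\<^esub> n = \<tau> [^]\<^bsub>G\<^esub> m \<otimes>\<^bsub>G\<^esub> \<sigma>"
    using carr by (metis int_pow_closed inv_solve_left m_closed)
  have form: "\<tau> [^]\<^bsub>G\<^esub> a \<otimes>\<^bsub>G\<^esub> \<sigma> [^]\<^bsub>G\<^esub> y = word_class R (word_int_pow Gen_t a @ replicate y (Gen_s, False))"
    for a :: int and y :: nat
    unfolding \<sigma>_def \<tau>_def G
    by (simp only: mult_presented_group flip: word_class_word_int_pow word_class_replicate)
  have val: "\<phi> (\<tau> [^]\<^bsub>G\<^esub> a \<otimes>\<^bsub>G\<^esub> \<sigma> [^]\<^bsub>G\<^esub> y) (0, 0) = (of_int a, - int y)" for a :: int and y :: nat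
    unfolding form \<phi> by (simp add: pow_s pow_t)
  show ?thesis
  proof (rule that[OF carr comm])
    fix a b :: int and y z :: nat
    assume "\<tau> [^]\<^bsub>G\<^esub> a \<otimes>\<^bsub>G\<^esub> \<sigma> [^]\<^bsub>G\<^esub> y = \<tau> [^]\<^bsub>G\<^esub> b \<otimes>\<^bsub>G\<^esub> \<sigma> [^]\<^bsub>G\<^esub> z"
    then have "(real_of_int a, - int y) = (real_of_int b, - int z)"
      using val by metis
    then show "a = b \<and> y = z" by simp
  qed
qed

text \<open>Neighbouring grid elements differ by a left factor from \<open>D\<close>, so their
  images under the action on one base point are a bounded step apart. Either kind of crossing
  contains \<open>Suc B\<close> distinct images in one component, one more than allowed.\<close>

lemma no_translation_like_action_commutation:
  fixes m n :: int
  assumes mn: "m \<noteq> 0" "n \<noteq> 0"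
    and T: "finite T" "symmetric_generating_set lamplighter T"
    and st: "\<sigma> \<in> carrier G" "\<tau> \<in> carrier G"
      "\<sigma> \<otimes>\<^bsub>G\<^esub> \<tau> [^]\<^bsub>G\<^esub> n = \<tau> [^]\<^bsub>G\<^esub> m \<otimes>\<^bsub>G\<^esub> \<sigma>"
    and inj: "\<And>a b y z. \<tau> [^]\<^bsub>G\<^esub> (a :: int) \<otimes>\<^bsub>G\<^esub> \<sigma> [^]\<^bsub>G\<^esub> (y :: nat) = \<tau> [^]\<^bsub>G\<^esub> b \<otimes>\<^bsub>G\<^esub> \<sigma> [^]\<^bsub>G\<^esub> z \<Longrightarrow>
      a = b \<and> y = z"
  shows "\<not> translation_like_action G (carrier lamplighter) (word_metric lamplighter T) act"
proof
  assume act: "translation_like_action G (carrier lamplighter) (word_metric lamplighter T) act"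
  interpret A: group_action G "carrier lamplighter" act
    using act unfolding translation_like_action_def by blast
  interpret group G using A.group_hom group_hom.axioms(1) by blast
  have free: "h = \<one>\<^bsub>G\<^esub>" if "h \<in> carrier G" "x \<in> carrier lamplighter" "act h x = x" for h x
    using act that unfolding translation_like_action_def by blast
  \<comment> \<open>\<open>K\<close> bounds the vertical error, remainders modulo \<open>n\<close>,
    and the horizontal exponent, which is at most \<open>1\<close> in absolute value.\<close>
  define K where "K = 2 * \<bar>m\<bar> + \<bar>n\<bar> + \<bar>m\<bar> * \<bar>n\<bar> + 1"
  have "K \<ge> 1" by (simp add: K_def)
  \<comment> \<open>The middle exponent \<open>- 1\<close>, \<open>0\<close> or \<open>1\<close>
    corresponds to a step down, along a row, or up.\<close>
  define D where "D = (\<lambda>(i, e, j). \<tau> [^]\<^bsub>G\<^esub> i \<otimes>\<^bsub>G\<^esub> \<sigma> [^]\<^bsub>G\<^esub> e \<otimes>\<^bsub>G\<^esub> \<tau> [^]\<^bsub>G\<^esub> j) ` ({- K..K} \<times> {- 1..1 :: int} \<times> {- K..K})"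
  have D_I: "\<tau> [^]\<^bsub>G\<^esub> i \<otimes>\<^bsub>G\<^esub> \<sigma> [^]\<^bsub>G\<^esub> e \<otimes>\<^bsub>G\<^esub> \<tau> [^]\<^bsub>G\<^esub> j \<in> D"
    if "\<bar>i\<bar> \<le> K" "\<bar>e\<bar> \<le> 1" "\<bar>j\<bar> \<le> K" for i e j :: int
    unfolding D_def using that by (intro image_eqI[of _ _ "(i, e, j)"]) auto
  have D: "finite D" "D \<subseteq> carrier G"
    using st(1,2) by (auto simp: D_def)
  obtain r where r: "r > 0"
    "\<And>h x. h \<in> D \<Longrightarrow> x \<in> carrier lamplighter \<Longrightarrow> lamp_near r x (act h x)"
    using translation_like_near[OF T act D] by metis
  obtain col B where B: "\<And>x. x \<in> carrier lamplighter \<Longrightarrow>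
    finite {y. (x, y) \<in> (lamp_steps r col)\<^sup>*} \<and> card {y. (x, y) \<in> (lamp_steps r col)\<^sup>*} \<le> B"
    using lamplighter_bounded_components[OF r(1)] by metis
  \<comment> \<open>\<open>D\<close>, and with it \<open>r\<close> and \<open>B\<close>, is fixed
    before the grid. Now \<open>k\<close> provides \<open>Suc B\<close> rows, and \<open>M\<close>
    provides \<open>Suc B\<close> columns in which \<open>bs_row\<close> is exact.\<close>
  define k where "k = Suc B"
  have "k > 0" by (simp add: k_def)
  define P where "P = nat ((\<bar>m\<bar> * \<bar>n\<bar>) ^ k)"
  have "P > 0" using mn by (simp add: P_def)
  define M where "M = P * Suc B"
  have "M > 0" using \<open>P > 0\<close> by (simp add: M_def)
  define w where "w = (\<lambda>(x, y). \<tau> [^]\<^bsub>G\<^esub> bs_row m n k x y \<otimes>\<^bsub>G\<^esub> \<sigma> [^]\<^bsub>G\<^esub> (y :: nat))"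
  have w_carrier: "w p \<in> carrier G" for p
    using st(1,2) by (simp add: w_def split: prod.split)
  have step_up: "\<exists>i j. \<bar>i\<bar> \<le> K \<and> \<bar>j\<bar> \<le> K \<and>
      w (x', Suc y) = (\<tau> [^]\<^bsub>G\<^esub> (i :: int) \<otimes>\<^bsub>G\<^esub> \<sigma> \<otimes>\<^bsub>G\<^esub> \<tau> [^]\<^bsub>G\<^esub> (j :: int)) \<otimes>\<^bsub>G\<^esub> w (x, y)"
    if xy: "Suc y \<le> k" "x \<le> Suc x'" "x' \<le> Suc x" for x x' y
  proof -
    define a where "a = bs_row m n k x y"
    define a' where "a' = bs_row m n k x' (Suc y)"
    \<comment> \<open>The factor with exponent \<open>j\<close> strips the remainder of
      \<open>a\<close> modulo \<open>n\<close>, \<open>\<sigma>\<close> turns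
      \<open>n * (a div n)\<close> into \<open>m * (a div n)\<close>, and \<open>i\<close> corrects
      the result to \<open>a'\<close>.\<close>
    define i where "i = a' - m * (a div n)"
    define j where "j = - (a mod n)"
    have "\<bar>i\<bar> \<le> K"
      using bs_row_vertical[OF mn xy] by (simp add: i_def a_def a'_def K_def)
    moreover have "\<bar>j\<bar> \<le> K"
    proof -
      have "\<bar>a mod n\<bar> < \<bar>n\<bar>" using mn(2) by (rule abs_mod_less)
      moreover have "0 \<le> \<bar>m\<bar> * \<bar>n\<bar>" by simp
      ultimately show ?thesis unfolding j_def K_def by linarith
    qed
    moreover have "w (x', Suc y) = (\<tau> [^]\<^bsub>G\<^esub> i \<otimes>\<^bsub>G\<^esub> \<sigma> \<otimes>\<^bsub>G\<^esub> \<tau> [^]\<^bsub>G\<^esub> j) \<otimes>\<^bsub>G\<^esub> w (x, y)"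
    proof -
      have c: "\<sigma> \<otimes>\<^bsub>G\<^esub> \<tau> [^]\<^bsub>G\<^esub> (n * (a div n)) = \<tau> [^]\<^bsub>G\<^esub> (m * (a div n)) \<otimes>\<^bsub>G\<^esub> \<sigma>"
        using commutation_int_pow[of "\<tau> [^]\<^bsub>G\<^esub> n" "\<tau> [^]\<^bsub>G\<^esub> m" \<sigma> "a div n"] st
        by (simp add: int_pow_pow)
      have ja: "j + a = n * (a div n)"
        by (simp add: j_def algebra_simps flip: minus_div_mult_eq_mod)
      have s: "\<sigma> \<otimes>\<^bsub>G\<^esub> \<sigma> [^]\<^bsub>G\<^esub> y = \<sigma> [^]\<^bsub>G\<^esub> Suc y"
        using nat_pow_Suc2[OF st(1)] by simp
      have "(\<tau> [^]\<^bsub>G\<^esub> i \<otimes>\<^bsub>G\<^esub> \<sigma> \<otimes>\<^bsub>G\<^esub> \<tau> [^]\<^bsub>G\<^esub> j) \<otimes>\<^bsub>G\<^esub> w (x, y)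
          = \<tau> [^]\<^bsub>G\<^esub> i \<otimes>\<^bsub>G\<^esub> (\<sigma> \<otimes>\<^bsub>G\<^esub> (\<tau> [^]\<^bsub>G\<^esub> j \<otimes>\<^bsub>G\<^esub> \<tau> [^]\<^bsub>G\<^esub> a)) \<otimes>\<^bsub>G\<^esub> \<sigma> [^]\<^bsub>G\<^esub> y"
        using st(1,2) by (simp add: w_def a_def m_assoc)
      also have "\<tau> [^]\<^bsub>G\<^esub> j \<otimes>\<^bsub>G\<^esub> \<tau> [^]\<^bsub>G\<^esub> a = \<tau> [^]\<^bsub>G\<^esub> (n * (a div n))"
        unfolding ja[symmetric] using int_pow_mult[OF st(2)] by simp
      also have "\<tau> [^]\<^bsub>G\<^esub> i \<otimes>\<^bsub>G\<^esub> (\<sigma> \<otimes>\<^bsub>G\<^esub> \<tau> [^]\<^bsub>G\<^esub> (n * (a div n))) \<otimes>\<^bsub>G\<^esub> \<sigma> [^]\<^bsub>G\<^esub> y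
          = (\<tau> [^]\<^bsub>G\<^esub> i \<otimes>\<^bsub>G\<^esub> \<tau> [^]\<^bsub>G\<^esub> (m * (a div n))) \<otimes>\<^bsub>G\<^esub> (\<sigma> \<otimes>\<^bsub>G\<^esub> \<sigma> [^]\<^bsub>G\<^esub> y)"
        unfolding c using st(1,2) by (simp add: m_assoc)
      also have "\<tau> [^]\<^bsub>G\<^esub> i \<otimes>\<^bsub>G\<^esub> \<tau> [^]\<^bsub>G\<^esub> (m * (a div n)) = \<tau> [^]\<^bsub>G\<^esub> a'"
        using int_pow_mult[OF st(2), of i "m * (a div n)"] by (simp add: i_def)
      finally show ?thesis
        unfolding s by (simp add: w_def a'_def)
    qed
    ultimately show ?thesis by blast
  qed
  have near: "\<exists>g\<in>D. w q = g \<otimes>\<^bsub>G\<^esub> w p"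
    if adj: "king_adj p q" and k: "snd p \<le> k" "snd q \<le> k" for p q
  proof -
    obtain x y x' y' where pq: "p = (x, y)" "q = (x', y')" by (cases p, cases q)
    have xx: "x \<le> Suc x'" "x' \<le> Suc x" and "y \<le> Suc y'" "y' \<le> Suc y"
      using adj by (simp_all add: king_adj_def pq)
    then consider "y' = y" | "y' = Suc y" | "y = Suc y'" by linarith
    then show ?thesis
    proof cases
      case 1
      define a where "a = bs_row m n k x y"
      define i where "i = bs_row m n k x' y - a"
      have "\<bar>i\<bar> \<le> 1"
        using bs_row_horizontal[OF mn _ xx, of y k] k by (simp add: i_def a_def pq)
      then have "\<tau> [^]\<^bsub>G\<^esub> i \<otimes>\<^bsub>G\<^esub> \<sigma> [^]\<^bsub>G\<^esub> (0 :: int) \<otimes>\<^bsub>G\<^esub> \<tau> [^]\<^bsub>G\<^esub> (0 :: int) \<in> D"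
        using \<open>K \<ge> 1\<close> by (intro D_I) auto
      then have "\<tau> [^]\<^bsub>G\<^esub> i \<in> D" using st(2) by simp
      moreover have "w q = \<tau> [^]\<^bsub>G\<^esub> i \<otimes>\<^bsub>G\<^esub> w p"
        using int_pow_mult[OF st(2), of i a] st(1,2)
        by (simp add: w_def pq 1 a_def[symmetric] i_def m_assoc[symmetric])
      ultimately show ?thesis by blast
    next
      case 2
      obtain i j where ij: "\<bar>i\<bar> \<le> K" "\<bar>j\<bar> \<le> K"
        "w q = (\<tau> [^]\<^bsub>G\<^esub> (i :: int) \<otimes>\<^bsub>G\<^esub> \<sigma> \<otimes>\<^bsub>G\<^esub> \<tau> [^]\<^bsub>G\<^esub> (j :: int)) \<otimes>\<^bsub>G\<^esub> w p"
        using step_up[OF _ xx, of y] k by (auto simp: pq 2)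
      have "\<tau> [^]\<^bsub>G\<^esub> i \<otimes>\<^bsub>G\<^esub> \<sigma> [^]\<^bsub>G\<^esub> (1 :: int) \<otimes>\<^bsub>G\<^esub> \<tau> [^]\<^bsub>G\<^esub> j \<in> D"
        using ij by (intro D_I) auto
      then show ?thesis using ij(3) st(1) by auto
    next
      \<comment> \<open>A step down is the inverse of a step up; \<open>D\<close> contains it
        because its exponent ranges are symmetric.\<close>
      case 3
      obtain i j where ij: "\<bar>i\<bar> \<le> K" "\<bar>j\<bar> \<le> K"
        "w p = (\<tau> [^]\<^bsub>G\<^esub> (i :: int) \<otimes>\<^bsub>G\<^esub> \<sigma> \<otimes>\<^bsub>G\<^esub> \<tau> [^]\<^bsub>G\<^esub> (j :: int)) \<otimes>\<^bsub>G\<^esub> w q"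
        using step_up[OF _ xx(2,1), of y'] k by (auto simp: pq 3)
      have "\<tau> [^]\<^bsub>G\<^esub> (- j) \<otimes>\<^bsub>G\<^esub> \<sigma> [^]\<^bsub>G\<^esub> (- 1 :: int) \<otimes>\<^bsub>G\<^esub> \<tau> [^]\<^bsub>G\<^esub> (- i) \<in> D"
        using ij by (intro D_I) auto
      moreover have "\<tau> [^]\<^bsub>G\<^esub> (- j) \<otimes>\<^bsub>G\<^esub> \<sigma> [^]\<^bsub>G\<^esub> (- 1 :: int) \<otimes>\<^bsub>G\<^esub> \<tau> [^]\<^bsub>G\<^esub> (- i)
          = inv\<^bsub>G\<^esub> (\<tau> [^]\<^bsub>G\<^esub> i \<otimes>\<^bsub>G\<^esub> \<sigma> \<otimes>\<^bsub>G\<^esub> \<tau> [^]\<^bsub>G\<^esub> j)"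
        using st(1,2) by (simp add: int_pow_neg inv_mult_group m_assoc)
      moreover have "w q = inv\<^bsub>G\<^esub> (\<tau> [^]\<^bsub>G\<^esub> i \<otimes>\<^bsub>G\<^esub> \<sigma> \<otimes>\<^bsub>G\<^esub> \<tau> [^]\<^bsub>G\<^esub> j) \<otimes>\<^bsub>G\<^esub> w p"
      proof -
        have "\<tau> [^]\<^bsub>G\<^esub> i \<otimes>\<^bsub>G\<^esub> \<sigma> \<otimes>\<^bsub>G\<^esub> \<tau> [^]\<^bsub>G\<^esub> j \<in> carrier G" (is "?g \<in> _")
          using st(1,2) by simp
        then have "inv\<^bsub>G\<^esub> ?g \<otimes>\<^bsub>G\<^esub> (?g \<otimes>\<^bsub>G\<^esub> w q) = w q"
          using m_assoc[of "inv\<^bsub>G\<^esub> ?g" ?g "w q"] w_carrier[of q] by simp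
        then show ?thesis unfolding ij(3) by (rule HOL.sym)
      qed
      ultimately show ?thesis by metis
    qed
  qed
  obtain x0 where x0: "x0 \<in> carrier lamplighter"
    using group.is_monoid[OF group_lamplighter] monoid.one_closed by blast
  define F where "F p = act (w p) x0" for p
  have F_carrier: "F p \<in> carrier lamplighter" for p
    unfolding F_def using A.element_image[OF w_carrier x0 HOL.refl] .
  have F_eq: "w p = w q" if "F p = F q" for p q
  proof -
    have "act (inv\<^bsub>G\<^esub> w q \<otimes>\<^bsub>G\<^esub> w p) x0 = act (inv\<^bsub>G\<^esub> w q) (F q)"
      using A.composition_rule[OF x0, of "inv\<^bsub>G\<^esub> w q" "w p"] w_carrier that by (simp add: F_def)
    also have "\<dots> = x0" using A.orbit_sym_aux[OF w_carrier x0] by (simp add: F_def)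
    finally have "inv\<^bsub>G\<^esub> w q \<otimes>\<^bsub>G\<^esub> w p = \<one>\<^bsub>G\<^esub>"
      using free[OF _ x0] w_carrier by simp
    moreover have "w p = w q \<otimes>\<^bsub>G\<^esub> (inv\<^bsub>G\<^esub> w q \<otimes>\<^bsub>G\<^esub> w p)"
      using w_carrier by (simp flip: m_assoc)
    ultimately show ?thesis using w_carrier by simp
  qed
  define E where "E = mono_steps ({1..M} \<times> {1..k}) (col \<circ> F)"
  have E_steps: "(F p, F q) \<in> lamp_steps r col" if "(p, q) \<in> E" for p q
  proof -
    have pq: "king_adj p q" "snd p \<le> k" "snd q \<le> k" "col (F p) = col (F q)"
      using that by (auto simp: E_def mono_steps_def)
    obtain g where g: "g \<in> D" "w q = g \<otimes>\<^bsub>G\<^esub> w p"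
      using near[OF pq(1-3)] by blast
    then have "F q = act g (F p)"
      using A.composition_rule[OF x0, of g "w p"] w_carrier D(2) by (auto simp: F_def)
    then show ?thesis
      using r(2)[OF g(1) F_carrier[of p]] pq(4) F_carrier[of p] F_carrier[of q]
      by (simp add: lamp_steps_def)
  qed
  have E_rtrancl: "(F p, F q) \<in> (lamp_steps r col)\<^sup>*" if "(p, q) \<in> E\<^sup>*" for p q
    using that by (induction rule: rtrancl_induct) (auto intro: rtrancl_into_rtrancl E_steps)
  have E_adj: "king_adj p q" if "(p, q) \<in> E" for p q
    using that by (auto simp: E_def mono_steps_def)
  \<comment> \<open>Pigeonhole: a chain from \<open>p\<close> maps into a component with at most
    \<open>B\<close> points.\<close>
  have few: "\<exists>i\<in>{1..Suc B}. \<exists>j\<in>{1..Suc B}. i \<noteq> j \<and> F (\<rho> i) = F (\<rho> j)"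
    if "\<And>i. i \<in> {1..Suc B} \<Longrightarrow> (p, \<rho> i) \<in> E\<^sup>*" for p \<rho>
  proof (rule ccontr)
    assume "\<not> ?thesis"
    then have "inj_on (F \<circ> \<rho>) {1..Suc B}" by (auto simp: inj_on_def)
    moreover have "(F \<circ> \<rho>) ` {1..Suc B} \<subseteq> {y. (F p, y) \<in> (lamp_steps r col)\<^sup>*}"
      using that E_rtrancl[of p "\<rho> _"] by (simp add: image_subset_iff)
    ultimately have "card {1..Suc B} \<le> card {y. (F p, y) \<in> (lamp_steps r col)\<^sup>*}"
      using B[OF F_carrier] by (metis card_inj_on_le)
    then show False using B[OF F_carrier[of p]] by simp
  qed
  obtain p q where pq: "(p, q) \<in> E\<^sup>*" "fst p = 1 \<and> fst q = M \<or> snd p = 1 \<and> snd q = k"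
    using grid_crossing[OF \<open>M > 0\<close> \<open>k > 0\<close>, of "col \<circ> F"] unfolding E_def[symmetric] by blast
  from pq(2) show False
  proof
    \<comment> \<open>The crossing meets all columns \<open>P * i\<close>. A collision there forces
      equal rows through the power of \<open>\<sigma>\<close>, after which exactness of
      \<open>bs_row\<close> forces equal \<open>i\<close>.\<close>
    assume h: "fst p = 1 \<and> fst q = M"
    have "\<exists>v. (p, v) \<in> E\<^sup>* \<and> fst v = P * i" if "i \<in> {1..Suc B}" for i
    proof (rule rtrancl_intermediate_value[OF pq(1)])
      show "fst b \<le> Suc (fst a)" if "(a, b) \<in> E" for a b
        using E_adj[OF that] by (simp add: king_adj_def)
      have "1 \<le> P * i" using \<open>P > 0\<close> that by simp
      then show "fst p \<le> P * i" using h by simp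
      have "P * i \<le> P * Suc B" using that by (intro mult_left_mono) auto
      then show "P * i \<le> fst q" using h by (simp add: M_def)
    qed
    then have "\<forall>i\<in>{1..Suc B}. \<exists>v. (p, v) \<in> E\<^sup>* \<and> fst v = P * i" by blast
    from bchoice[OF this] obtain \<rho>
      where \<rho>: "\<And>i. i \<in> {1..Suc B} \<Longrightarrow> (p, \<rho> i) \<in> E\<^sup>* \<and> fst (\<rho> i) = P * i"
      by blast
    have "\<exists>i\<in>{1..Suc B}. \<exists>j\<in>{1..Suc B}. i \<noteq> j \<and> F (\<rho> i) = F (\<rho> j)"
      by (rule few[of p \<rho>]) (use \<rho> in blast)
    then obtain i j where ij: "i \<in> {1..Suc B}" "j \<in> {1..Suc B}" "i \<noteq> j" "F (\<rho> i) = F (\<rho> j)"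
      by blast
    obtain y z where yz: "\<rho> i = (P * i, y)" "\<rho> j = (P * j, z)"
      using \<rho>[OF ij(1)] \<rho>[OF ij(2)] by (metis prod.collapse)
    have "bs_row m n k (P * i) y = bs_row m n k (P * j) z \<and> y = z"
      using F_eq[OF ij(4)] inj by (simp add: w_def yz)
    then have "int i * (m ^ y * n ^ (k - y)) = int j * (m ^ y * n ^ (k - y))"
      unfolding P_def using bs_row_multiple[OF mn] by metis
    with mn ij(3) show False by simp
  next
    \<comment> \<open>Here the crossing meets all rows, and the power of \<open>\<sigma>\<close>
      alone tells them apart.\<close>
    assume h: "snd p = 1 \<and> snd q = k"
    have "\<exists>v. (p, v) \<in> E\<^sup>* \<and> snd v = i" if "i \<in> {1..Suc B}" for i
    proof (rule rtrancl_intermediate_value[OF pq(1)])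
      show "snd b \<le> Suc (snd a)" if "(a, b) \<in> E" for a b
        using E_adj[OF that] by (simp add: king_adj_def)
      show "snd p \<le> i" "i \<le> snd q" using h that by (simp_all add: k_def)
    qed
    then have "\<forall>i\<in>{1..Suc B}. \<exists>v. (p, v) \<in> E\<^sup>* \<and> snd v = i" by blast
    from bchoice[OF this] obtain \<rho>
      where \<rho>: "\<And>i. i \<in> {1..Suc B} \<Longrightarrow> (p, \<rho> i) \<in> E\<^sup>* \<and> snd (\<rho> i) = i"
      by blast
    have "\<exists>i\<in>{1..Suc B}. \<exists>j\<in>{1..Suc B}. i \<noteq> j \<and> F (\<rho> i) = F (\<rho> j)"
      by (rule few[of p \<rho>]) (use \<rho> in blast)
    then obtain i j where ij: "i \<in> {1..Suc B}" "j \<in> {1..Suc B}" "i \<noteq> j" "F (\<rho> i) = F (\<rho> j)"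
      by blast
    obtain x x' where yz: "\<rho> i = (x, i)" "\<rho> j = (x', j)"
      using \<rho>[OF ij(1)] \<rho>[OF ij(2)] by (metis prod.collapse)
    have "bs_row m n k x i = bs_row m n k x' j \<and> i = j"
      using F_eq[OF ij(4)] inj by (simp add: w_def yz)
    with ij(3) show False by simp
  qed
qed

text \<open>The excluded pairs are those whose relation says \<open>t = 1\<close>. The group is then
  infinite cyclic and does act translation-like, by right translations along an element of infinite
  order.\<close>

theorem corollary3p4:
  fixes m n :: int and T :: "((int \<Rightarrow> int) \<times> int) set"
  assumes nondegenerate: "{\<bar>m\<bar>, \<bar>n\<bar>} \<noteq> {0, 1}"
    and "finite T"
    and "symmetric_generating_set lamplighter T"
  shows "\<not> (\<exists>act. translation_like_action (baumslag_solitar m n)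
                  (carrier lamplighter) (word_metric lamplighter T) act)"
proof (cases "m = 0 \<or> n = 0")
  case True
  then show ?thesis
    using no_translation_like_action_degenerate[OF nondegenerate True assms(2,3)] by blast
next
  case False
  then have "m \<noteq> 0" "n \<noteq> 0" by auto
  from baumslag_solitar_distinct_powers[OF this] show ?thesis
    using no_translation_like_action_commutation[OF \<open>m \<noteq> 0\<close> \<open>n \<noteq> 0\<close> assms(2,3)] by metis
qed

end
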